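(* Let $G$ be a connected, reductive algebraic group over an algebraically closed field $k$ of characteristic $p>0$. Let $H$ be a closed, connected, reductive subgroup of $G$ contained in a parabolic subgroup $P=R_u(P)L$ of $G$, where $R_u(P)$ is the unipotent radical and $L$ a Levi subgroup of $P$. Then there exists a finite subgroup $H(q)$ of $H$, with $q$ a power of $p$, such that $H(q)$ is conjugate in $G$ to a subgroup of $L$ if and only if $H$ is conjugate in $G$ to a subgroup of $L$.
   Context: For a connected reductive group $H$ with a (split) structure over the prime field $\mathbb{F}_p$ and $q=p^r$, $H(q)$ denotes the finite reductive group of fixed points in $H(k)$ of the Frobenius morphism $F_r$ induced by $x\mapsto x^{p^r}$. A Levi subgroup $L$ of a parabolic $P$ is a closed complement to $R_u(P)$ in $P$. *)

theory Defs
  imports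
    "Jordan_Normal_Form.Determinant"
    "HOL-Algebra.Solvable_Groups"
    "HOL-Analysis.Function_Topology"
begin

text \<open>
  Affine algebraic groups over the algebraically closed field \<open>'a\<close> are closed subgroups of some
  \<open>GL n\<close>, given by their points over \<open>'a\<close>.
\<close>

definition GL :: "nat \<Rightarrow> 'a::field mat monoid" where
  "GL n = units_of (ring_mat TYPE('a) n ())"

abbreviation subgrp :: "nat \<Rightarrow> 'a::field mat set \<Rightarrow> 'a mat monoid" where
  "subgrp n H \<equiv> (GL n)\<lparr>carrier := H\<rparr>"

text \<open>
  \<open>regular_funs K n\<close> is the algebra \<open>K[x\<^sub>i\<^sub>j, 1/det]\<close>. Its elements are total functions on
  matrices; only their values on \<open>carrier (GL n)\<close> are meaningful.
\<close>

inductive_set regular_funs :: "'a::field set \<Rightarrow> nat \<Rightarrow> ('a mat \<Rightarrow> 'a) set"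
  for K :: "'a set" and n :: nat where
  const: "c \<in> K \<Longrightarrow> (\<lambda>_. c) \<in> regular_funs K n"
| entry: "i < n \<Longrightarrow> j < n \<Longrightarrow> (\<lambda>A. A $$ (i, j)) \<in> regular_funs K n"
| inv_det: "(\<lambda>A. inverse (det A)) \<in> regular_funs K n"
| add: "f \<in> regular_funs K n \<Longrightarrow> g \<in> regular_funs K n \<Longrightarrow> (\<lambda>A. f A + g A) \<in> regular_funs K n"
| mult: "f \<in> regular_funs K n \<Longrightarrow> g \<in> regular_funs K n \<Longrightarrow> (\<lambda>A. f A * g A) \<in> regular_funs K n"

text \<open>The principal open sets are a basis of the Zariski topology.\<close>

definition zariski :: "nat \<Rightarrow> 'a::field mat topology" where
  "zariski n =
     topology_generated_by ((\<lambda>f. {A \<in> carrier (GL n). f A \<noteq> 0}) ` regular_funs UNIV n)"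

definition closed_subgroup :: "nat \<Rightarrow> 'a::field mat set \<Rightarrow> bool" where
  "closed_subgroup n H \<longleftrightarrow> subgroup H (GL n) \<and> closedin (zariski n) H"

definition connected_subgroup :: "nat \<Rightarrow> 'a::field mat set \<Rightarrow> bool" where
  "connected_subgroup n H \<longleftrightarrow> closed_subgroup n H \<and> connectedin (zariski n) H"

definition unipotent :: "nat \<Rightarrow> 'a::field mat \<Rightarrow> bool" where
  "unipotent n A \<longleftrightarrow> A \<in> carrier (GL n) \<and> (\<exists>k. (A - 1\<^sub>m n) ^\<^sub>m k = 0\<^sub>m n n)"

text \<open>
  The greatest closed connected normal unipotent subgroup; it exists for every closed \<open>H\<close>.
\<close>

definition unipotent_radical :: "nat \<Rightarrow> 'a::field mat set \<Rightarrow> 'a mat set" where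
  "unipotent_radical n H =
     (GREATEST U. connected_subgroup n U \<and> U \<lhd> subgrp n H \<and> (\<forall>A\<in>U. unipotent n A))"

definition reductive :: "nat \<Rightarrow> 'a::field mat set \<Rightarrow> bool" where
  "reductive n H \<longleftrightarrow> closed_subgroup n H \<and> unipotent_radical n H = {\<one>\<^bsub>GL n\<^esub>}"

definition borel_subgroup :: "nat \<Rightarrow> 'a::field mat set \<Rightarrow> 'a mat set \<Rightarrow> bool" where
  "borel_subgroup n G B \<longleftrightarrow>
     (connected_subgroup n B \<and> B \<subseteq> G \<and> solvable (subgrp n B)) \<and>
     (\<forall>C. connected_subgroup n C \<and> C \<subseteq> G \<and> solvable (subgrp n C) \<and> B \<subseteq> C \<longrightarrow> C = B)"

definition parabolic_subgroup :: "nat \<Rightarrow> 'a::field mat set \<Rightarrow> 'a mat set \<Rightarrow> bool" where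
  "parabolic_subgroup n G P \<longleftrightarrow>
     closed_subgroup n P \<and> P \<subseteq> G \<and> (\<exists>B. borel_subgroup n G B \<and> B \<subseteq> P)"

definition levi_subgroup :: "nat \<Rightarrow> 'a::field mat set \<Rightarrow> 'a mat set \<Rightarrow> bool" where
  "levi_subgroup n P L \<longleftrightarrow>
     closed_subgroup n L \<and> L \<subseteq> P \<and>
     P = unipotent_radical n P <#>\<^bsub>GL n\<^esub> L \<and>
     unipotent_radical n P \<inter> L = {\<one>\<^bsub>GL n\<^esub>}"

definition conjugate_to_subgroup ::
    "nat \<Rightarrow> 'a::field mat set \<Rightarrow> 'a mat set \<Rightarrow> 'a mat set \<Rightarrow> bool" where
  "conjugate_to_subgroup n G X L \<longleftrightarrow>
     (\<exists>g\<in>G. subgroup ((\<lambda>x. g \<otimes>\<^bsub>GL n\<^esub> x \<otimes>\<^bsub>GL n\<^esub> inv\<^bsub>GL n\<^esub> g) ` X) (subgrp n L))"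

text \<open>
  For a subfield \<open>K\<close>: the ideal of functions in \<open>'a[x\<^sub>i\<^sub>j, 1/det]\<close> vanishing on \<open>X\<close> is spanned
  over \<open>'a\<close> by its elements with coefficients in \<open>K\<close>.
\<close>

definition defined_over :: "'a::field set \<Rightarrow> nat \<Rightarrow> 'a mat set \<Rightarrow> bool" where
  "defined_over K n X \<longleftrightarrow>
     (\<forall>f\<in>regular_funs UNIV n. (\<forall>A\<in>X. f A = 0) \<longrightarrow>
        (\<exists>F c. finite F \<and> F \<subseteq> {h \<in> regular_funs K n. \<forall>A\<in>X. h A = 0} \<and>
           (\<forall>A\<in>carrier (GL n). f A = (\<Sum>h\<in>F. c h * h A))))"

definition regular_map_over ::
    "'a::field set \<Rightarrow> nat \<Rightarrow> 'a mat set \<Rightarrow> nat \<Rightarrow> ('a mat \<Rightarrow> 'a mat) \<Rightarrow> bool" where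
  "regular_map_over K n X m \<phi> \<longleftrightarrow>
     (\<forall>i<m. \<forall>j<m. \<exists>f\<in>regular_funs K n. \<forall>A\<in>X. \<phi> A $$ (i, j) = f A)"

definition alg_group_iso_over ::
    "'a::field set \<Rightarrow> nat \<Rightarrow> 'a mat set \<Rightarrow> nat \<Rightarrow> 'a mat set \<Rightarrow> ('a mat \<Rightarrow> 'a mat) \<Rightarrow> bool" where
  "alg_group_iso_over K n X m Y \<phi> \<longleftrightarrow>
     \<phi> \<in> iso (subgrp n X) (subgrp m Y) \<and>
     regular_map_over K n X m \<phi> \<and> regular_map_over K m Y n (inv_into X \<phi>)"

definition diagonal_group :: "nat \<Rightarrow> 'a::field mat set" where
  "diagonal_group d = {A \<in> carrier (GL d). diagonal_mat A}"

definition torus :: "nat \<Rightarrow> 'a::field mat set \<Rightarrow> bool" where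
  "torus n T \<longleftrightarrow>
     closed_subgroup n T \<and> (\<exists>d \<phi>. alg_group_iso_over UNIV n T d (diagonal_group d) \<phi>)"

definition split_torus_over :: "'a::field set \<Rightarrow> nat \<Rightarrow> 'a mat set \<Rightarrow> bool" where
  "split_torus_over K n T \<longleftrightarrow>
     closed_subgroup n T \<and> defined_over K n T \<and>
     (\<exists>d \<phi>. alg_group_iso_over K n T d (diagonal_group d) \<phi>)"

definition maximal_torus :: "nat \<Rightarrow> 'a::field mat set \<Rightarrow> 'a mat set \<Rightarrow> bool" where
  "maximal_torus n G T \<longleftrightarrow>
     torus n T \<and> T \<subseteq> G \<and> (\<forall>S. torus n S \<and> S \<subseteq> G \<and> T \<subseteq> S \<longrightarrow> S = T)"

text \<open>In characteristic \<open>p > 0\<close> the multiples of \<open>1\<close> form the prime field.\<close>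

definition prime_field :: "'a::field set" where
  "prime_field = range of_nat"

text \<open>
  A split structure over the prime field on \<open>H\<close>: an algebraic group \<open>H\<^sub>0\<close> in \<open>GL m\<close> defined over
  the prime field, with a maximal torus that is split over the prime field, together with an
  isomorphism \<open>\<phi>\<close> from \<open>H\<^sub>0\<close> to \<open>H\<close> over \<open>'a\<close>.
\<close>

definition split_prime_structure ::
    "nat \<Rightarrow> 'a::field mat set \<Rightarrow> nat \<Rightarrow> 'a mat set \<Rightarrow> ('a mat \<Rightarrow> 'a mat) \<Rightarrow> bool" where
  "split_prime_structure n H m H\<^sub>0 \<phi> \<longleftrightarrow>
     closed_subgroup m H\<^sub>0 \<and> defined_over prime_field m H\<^sub>0 \<and>
     (\<exists>T. maximal_torus m H\<^sub>0 T \<and> split_torus_over prime_field m T) \<and>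
     alg_group_iso_over UNIV m H\<^sub>0 n H \<phi>"

text \<open>
  The Frobenius morphism \<open>F\<^sub>r\<close> of \<open>H\<close>, with \<open>p = CHAR('a)\<close>: the map \<open>x \<mapsto> x^(p^r)\<close> on the matrix
  entries of \<open>H\<^sub>0\<close>, transported along \<open>\<phi>\<close>.
\<close>

definition frobenius ::
    "nat \<Rightarrow> 'a::field mat set \<Rightarrow> ('a mat \<Rightarrow> 'a mat) \<Rightarrow> 'a mat \<Rightarrow> 'a mat" where
  "frobenius r H\<^sub>0 \<phi> h = \<phi> (map_mat (\<lambda>x. x ^ (CHAR('a) ^ r)) (inv_into H\<^sub>0 \<phi> h))"

definition frobenius_fixed ::
    "nat \<Rightarrow> 'a::field mat set \<Rightarrow> 'a mat set \<Rightarrow> ('a mat \<Rightarrow> 'a mat) \<Rightarrow> 'a mat set" where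
  "frobenius_fixed r H H\<^sub>0 \<phi> = {h \<in> H. frobenius r H\<^sub>0 \<phi> h = h}"

end

theory Submission
  imports Defs "HOL-Library.Function_Algebras" "HOL-Computational_Algebra.Primes"
begin

text \<open>
  Let \<open>k\<^sub>0\<close> be the algebraic closure of the prime field in the ground field, so that the points of
  \<open>H\<close> over \<open>k\<^sub>0\<close> are the union of the groups \<open>H(p\<^sup>r)\<close>. The elements \<open>g\<close> that conjugate a given
  subset of \<open>H\<close> into \<open>L\<close> form a closed set. By Hilbert's basis theorem the condition that \<open>g\<close>
  conjugates all of \<open>H(k\<^sub>0)\<close> into \<open>L\<close> already follows from the conditions at finitely many elements
  of \<open>H(k\<^sub>0)\<close>, and these lie in a single \<open>H(p\<^sup>r)\<close>. Finally \<open>H(k\<^sub>0)\<close> is dense in \<open>H\<close> by a version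
  of the Nullstellensatz, so an element that conjugates \<open>H(p\<^sup>r)\<close> into \<open>L\<close> conjugates \<open>H\<close> into \<open>L\<close>.
\<close>

section \<open>Hilbert's basis theorem\<close>

text \<open>In passing from \<open>H(q)\<close> to \<open>H\<close>, the exponent has to be fixed
  before a conjugating element is known. The elements supplied by the basis theorem depend only on
  \<open>L\<close>, \<open>H\<close> and its split structure, so one \<open>q\<close> serves every
  \<open>g\<close>; the same \<open>g\<close> then works for both groups.

  All rings are subsets of one ambient ring: the functions on matrices, or the field itself.
  Adjoining an element therefore stays in the same type, and induction along a list of generators
  serves twice: for the Noetherian property of regular functions, and for homomorphisms from
  finitely generated subrings of the field into the small field.

  Density comes from specialisation. A matrix of \<open>H\<^sub>0\<close> has entries in a ring
  finitely generated over the small field. A homomorphism from this ring to the small field, applied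
  entrywise, keeps the matrix inside \<open>H\<^sub>0\<close>, whose equations have coefficients in
  the prime field, and it can be chosen so that a given nonzero value \<open>f A\<close> stays
  nonzero. This treats functions with coefficients in the small field; arbitrary coefficients are
  then handled by elimination.\<close>

definition is_subring :: "'b::comm_ring_1 set \<Rightarrow> bool" where
  "is_subring S \<longleftrightarrow> 1 \<in> S \<and> (\<forall>x\<in>S. \<forall>y\<in>S. x - y \<in> S \<and> x * y \<in> S)"

lemma subring_one: "is_subring S \<Longrightarrow> 1 \<in> S"
  and subring_diff: "is_subring S \<Longrightarrow> x \<in> S \<Longrightarrow> y \<in> S \<Longrightarrow> x - y \<in> S"
  and subring_mult: "is_subring S \<Longrightarrow> x \<in> S \<Longrightarrow> y \<in> S \<Longrightarrow> x * y \<in> S"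
  by (auto simp: is_subring_def)

lemma subring_zero: "is_subring S \<Longrightarrow> 0 \<in> S"
  using subring_diff[of S 1 1] by (simp add: subring_one)

lemma subring_uminus: "is_subring S \<Longrightarrow> x \<in> S \<Longrightarrow> - x \<in> S"
  using subring_diff[of S 0 x] by (simp add: subring_zero)

lemma subring_add: "is_subring S \<Longrightarrow> x \<in> S \<Longrightarrow> y \<in> S \<Longrightarrow> x + y \<in> S"
  using subring_diff[of S x "- y"] by (simp add: subring_uminus)

lemma subring_sum: "is_subring S \<Longrightarrow> (\<And>i. i \<in> I \<Longrightarrow> f i \<in> S) \<Longrightarrow> sum f I \<in> S"
  by (induction I rule: infinite_finite_induct) (auto simp: subring_zero subring_add)

lemma subring_prod: "is_subring S \<Longrightarrow> (\<And>i. i \<in> I \<Longrightarrow> f i \<in> S) \<Longrightarrow> prod f I \<in> S"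
  by (induction I rule: infinite_finite_induct) (auto simp: subring_one subring_mult)

lemma subring_power: "is_subring S \<Longrightarrow> x \<in> S \<Longrightarrow> x ^ k \<in> S"
  by (induction k) (auto simp: subring_one subring_mult)

definition polys_over :: "'b::comm_ring_1 set \<Rightarrow> 'b poly set" where
  "polys_over S = {p. \<forall>i. coeff p i \<in> S}"

text \<open>The ring \<open>S[x]\<close> as the image of evaluation at \<open>x\<close>. Polynomials
  serve as representatives of its elements; they are in general not unique.\<close>

definition adjoin :: "'b::comm_ring_1 set \<Rightarrow> 'b \<Rightarrow> 'b set" where
  "adjoin S x = (\<lambda>p. poly p x) ` polys_over S"

lemma monom_polys_over: "is_subring S \<Longrightarrow> c \<in> S \<Longrightarrow> monom c k \<in> polys_over S"
  by (auto simp: polys_over_def subring_zero)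

lemma is_subring_polys_over:
  assumes "is_subring S"
  shows "is_subring (polys_over S)"
  using assms unfolding is_subring_def[of "polys_over S"]
  by (auto simp: polys_over_def coeff_mult subring_one subring_zero
      intro!: subring_diff subring_sum subring_mult)

lemma is_subring_adjoin:
  assumes "is_subring S"
  shows "is_subring (adjoin S x)"
proof -
  note P = is_subring_polys_over[OF assms]
  show ?thesis
    unfolding is_subring_def adjoin_def
    using subring_one[OF P] subring_diff[OF P] subring_mult[OF P]
    by (auto simp: image_iff simp flip: poly_diff poly_mult intro: bexI[of _ 1])
qed

lemma subset_adjoin: "is_subring S \<Longrightarrow> S \<subseteq> adjoin S x"
  unfolding adjoin_def using monom_polys_over[of S _ 0]
  by (auto simp: image_iff poly_monom intro!: bexI[of _ "monom _ 0"])

lemma generator_in_adjoin: "is_subring S \<Longrightarrow> x \<in> adjoin S x"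
  unfolding adjoin_def using monom_polys_over[of S 1 1]
  by (auto simp: image_iff poly_monom subring_one intro!: bexI[of _ "monom 1 1"])

text \<open>\<open>Q\<close> stands for a property preserved by a single adjunction. It is
  instantiated by the Noetherian property, by separation of points, and by \<open>True\<close> where
  only the inclusions are wanted.\<close>

lemma foldl_adjoin:
  assumes "is_subring S" "\<And>R x. is_subring R \<Longrightarrow> Q R \<Longrightarrow> Q (adjoin R x)" "Q S"
  shows "is_subring (foldl adjoin S xs)" "S \<subseteq> foldl adjoin S xs"
    "set xs \<subseteq> foldl adjoin S xs" "Q (foldl adjoin S xs)"
proof -
  have "is_subring (foldl adjoin S xs) \<and> S \<subseteq> foldl adjoin S xs \<and>
      set xs \<subseteq> foldl adjoin S xs \<and> Q (foldl adjoin S xs)"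
  proof (induction xs rule: rev_induct)
    case Nil
    then show ?case using assms by auto
  next
    case (snoc x xs)
    then show ?case
      using subset_adjoin[of "foldl adjoin S xs" x]
      by (auto simp: is_subring_adjoin generator_in_adjoin assms(2))
  qed
  then show "is_subring (foldl adjoin S xs)" "S \<subseteq> foldl adjoin S xs"
    "set xs \<subseteq> foldl adjoin S xs" "Q (foldl adjoin S xs)" by auto
qed

section \<open>Generated ideals and the chain condition\<close>

inductive_set ideal_gen :: "'b::comm_ring_1 set \<Rightarrow> 'b set \<Rightarrow> 'b set" for S F where
  zero: "0 \<in> ideal_gen S F"
| step: "s \<in> S \<Longrightarrow> f \<in> F \<Longrightarrow> a \<in> ideal_gen S F \<Longrightarrow> s * f + a \<in> ideal_gen S F"

text \<open>The finite generating set has to be a subset of the given \<open>F\<close>. In the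
  application this returns equations that belong to actual group elements.\<close>

definition noetherian :: "'b::comm_ring_1 set \<Rightarrow> bool" where
  "noetherian S \<longleftrightarrow> (\<forall>F\<subseteq>S. \<exists>F'\<subseteq>F. finite F' \<and> F \<subseteq> ideal_gen S F')"

lemma ideal_gen_base: "is_subring S \<Longrightarrow> f \<in> F \<Longrightarrow> f \<in> ideal_gen S F"
  using ideal_gen.step[OF subring_one _ ideal_gen.zero] by fastforce

lemma ideal_gen_add:
  "a \<in> ideal_gen S F \<Longrightarrow> b \<in> ideal_gen S F \<Longrightarrow> a + b \<in> ideal_gen S F"
  by (induction rule: ideal_gen.induct) (auto simp: add.assoc intro: ideal_gen.step)

lemma ideal_gen_mult:
  assumes "is_subring S" "a \<in> ideal_gen S F" "s \<in> S"
  shows "s * a \<in> ideal_gen S F"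
  using assms(2)
proof induction
  case (step r f a)
  then show ?case
    using ideal_gen.step[of "s * r" S f F "s * a"] assms
    by (auto simp: algebra_simps subring_mult)
qed (auto intro: ideal_gen.zero)

lemma ideal_gen_diff:
  assumes "is_subring S" "a \<in> ideal_gen S F" "b \<in> ideal_gen S F"
  shows "a - b \<in> ideal_gen S F"
  using ideal_gen_add[OF assms(2) ideal_gen_mult[OF assms(1,3), of "- 1"]] assms(1)
  by (simp add: subring_one subring_uminus)

lemma ideal_gen_trans:
  assumes "is_subring S" "F \<subseteq> ideal_gen S E"
  shows "ideal_gen S F \<subseteq> ideal_gen S E"
proof
  fix a assume "a \<in> ideal_gen S F"
  then show "a \<in> ideal_gen S E"
    by induction (use assms in \<open>auto intro!: ideal_gen.zero ideal_gen_add ideal_gen_mult\<close>)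
qed

lemma ideal_gen_mono: "is_subring S \<Longrightarrow> F \<subseteq> E \<Longrightarrow> ideal_gen S F \<subseteq> ideal_gen S E"
  by (rule ideal_gen_trans) (auto intro: ideal_gen_base)

lemma ideal_gen_finite:
  assumes "is_subring S" "a \<in> ideal_gen S F"
  shows "\<exists>F'\<subseteq>F. finite F' \<and> a \<in> ideal_gen S F'"
  using assms(2)
proof induction
  case zero
  show ?case by (intro exI[of _ "{}"]) (auto intro: ideal_gen.zero)
next
  case (step s f a)
  then obtain F' where "F' \<subseteq> F" "finite F'" "a \<in> ideal_gen S F'" by auto
  then show ?case
    using step ideal_gen_mono[OF assms(1), of F' "insert f F'"]
    by (intro exI[of _ "insert f F'"]) (auto intro!: ideal_gen.step)
qed

lemma ideal_gen_finite_set: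
  assumes "is_subring S" "finite E" "E \<subseteq> ideal_gen S F"
  shows "\<exists>F'\<subseteq>F. finite F' \<and> E \<subseteq> ideal_gen S F'"
  using assms(2,3)
proof (induction E)
  case empty
  show ?case by (intro exI[of _ "{}"]) auto
next
  case (insert e E)
  then obtain F' where F': "F' \<subseteq> F" "finite F'" "E \<subseteq> ideal_gen S F'" by auto
  obtain F'' where F'': "F'' \<subseteq> F" "finite F''" "e \<in> ideal_gen S F''"
    using insert ideal_gen_finite[OF assms(1), of e F] by auto
  show ?case
    using F' F'' ideal_gen_mono[OF assms(1), of F' "F' \<union> F''"]
      ideal_gen_mono[OF assms(1), of F'' "F' \<union> F''"]
    by (intro exI[of _ "F' \<union> F''"]) auto
qed

lemma noetherian_sequence:
  assumes "is_subring S" "noetherian S" "\<And>i. a i \<in> S"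
  shows "\<exists>N. a N \<in> ideal_gen S (a ` {..<N::nat})"
proof -
  obtain F where F: "F \<subseteq> range a" "finite F" "range a \<subseteq> ideal_gen S F"
    using assms unfolding noetherian_def by (meson image_subsetI)
  obtain I where I: "finite I" "F = a ` I"
    using finite_subset_image[OF F(2,1)] by auto
  then have "I \<subseteq> {..<Suc (Max I)}" by (auto simp: less_Suc_eq_le)
  then have "F \<subseteq> a ` {..<Suc (Max I)}" using I by auto
  then have "ideal_gen S F \<subseteq> ideal_gen S (a ` {..<Suc (Max I)})"
    by (rule ideal_gen_mono[OF assms(1)])
  then show ?thesis using F by blast
qed

text \<open>Multiplying \<open>Q i\<close> by a monomial of degree \<open>D - degree (Q i)\<close>
  moves its leading term to degree \<open>D\<close>, so a relation between leading coefficients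
  lifts to polynomials. The conclusion concerns the coefficient at \<open>D\<close>, not the leading
  one, because \<open>c\<close> may be 0.\<close>

lemma lift_leading_coeff:
  assumes S: "is_subring S" and Q: "\<And>i. i \<in> I \<Longrightarrow> Q i \<in> polys_over S \<and> degree (Q i) \<le> D"
    and c: "c \<in> ideal_gen S ((\<lambda>i. lead_coeff (Q i)) ` I)"
  shows "\<exists>W\<in>polys_over S. degree W \<le> D \<and> coeff W D = c \<and>
           poly W x \<in> ideal_gen (adjoin S x) ((\<lambda>i. poly (Q i) x) ` I)"
  using c
proof induction
  case zero
  show ?case using subring_zero[OF is_subring_polys_over[OF S]]
    by (intro bexI[of _ 0]) (auto intro: ideal_gen.zero)
next
  case (step s f a)
  then obtain i W where i: "i \<in> I" "f = lead_coeff (Q i)"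
    and W: "W \<in> polys_over S" "degree W \<le> D" "coeff W D = a"
      "poly W x \<in> ideal_gen (adjoin S x) ((\<lambda>i. poly (Q i) x) ` I)" by auto
  let ?M = "monom s (D - degree (Q i))"
  note P = is_subring_polys_over[OF S]
  have M: "?M \<in> polys_over S" using S step by (auto intro: monom_polys_over)
  have Qi: "Q i \<in> polys_over S" "degree (Q i) \<le> D" using Q i by auto
  have d: "degree (?M * Q i) \<le> D"
    using Qi degree_mult_le[of ?M "Q i"] degree_monom_le[of s "D - degree (Q i)"] by linarith
  have co: "coeff (?M * Q i) D = s * f"
    using Qi i by (simp add: coeff_monom_mult)
  have "poly ?M x \<in> adjoin S x" using M by (auto simp: adjoin_def)
  then have "poly (?M * Q i + W) x \<in> ideal_gen (adjoin S x) ((\<lambda>i. poly (Q i) x) ` I)"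
    using W i by (auto intro!: ideal_gen.step)
  then show ?case
    using W d co Qi M
    by (intro bexI[of _ "?M * Q i + W"])
      (auto intro!: subring_add[OF P] subring_mult[OF P] degree_add_le)
qed

text \<open>Hilbert's argument: elements outside the ideal generated so far are chosen with
  representatives of least degree. By the chain condition in \<open>S\<close> some leading
  coefficient depends on the earlier ones, and subtracting the lifted combination contradicts
  minimality.\<close>

lemma noetherian_adjoin:
  assumes S: "is_subring S" and "noetherian S"
  shows "noetherian (adjoin S x)"
  unfolding noetherian_def
proof (intro allI impI, rule ccontr)
  let ?T = "adjoin S x"
  note T = is_subring_adjoin[OF S, of x] and P = is_subring_polys_over[OF S]
  fix F assume F: "F \<subseteq> ?T" and notfg: "\<not> (\<exists>F'\<subseteq>F. finite F' \<and> F \<subseteq> ideal_gen ?T F')"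
  \<comment> \<open>The candidates at stage \<open>N\<close>: their value lies in the ideal of
    \<open>F\<close> but not in the one generated by the first \<open>N\<close> chosen values.
    Degrees are measured on polynomial representatives, since elements of \<open>?T\<close> have
    none.\<close>
  define C where "C Q N = {p \<in> polys_over S. poly p x \<in> ideal_gen ?T F \<and>
      poly p x \<notin> ideal_gen ?T ((\<lambda>i. poly (Q i) x) ` {..<N})}" for Q :: "nat \<Rightarrow> 'a poly" and N
  have "\<exists>Q. \<forall>N. Q N \<in> C Q N \<and> (\<forall>p\<in>C Q N. degree (Q N) \<le> degree p)"
  proof (rule dependent_wellorder_choice)
    fix r :: "'a poly" and f g :: "nat \<Rightarrow> 'a poly" and N
    assume "\<And>y. y < N \<Longrightarrow> f y = g y"
    then have "(\<lambda>i. poly (f i) x) ` {..<N} = (\<lambda>i. poly (g i) x) ` {..<N}" by auto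
    then have "C f N = C g N" by (simp add: C_def)
    then show "(r \<in> C f N \<and> (\<forall>p\<in>C f N. degree r \<le> degree p)) =
        (r \<in> C g N \<and> (\<forall>p\<in>C g N. degree r \<le> degree p))" by simp
  next
    fix N :: nat and Q :: "nat \<Rightarrow> 'a poly"
    assume Q: "\<And>y. y < N \<Longrightarrow> Q y \<in> C Q y \<and> (\<forall>p\<in>C Q y. degree (Q y) \<le> degree p)"
    let ?E = "(\<lambda>i. poly (Q i) x) ` {..<N}"
    have "?E \<subseteq> ideal_gen ?T F" using Q by (auto simp: C_def)
    then obtain F' where F': "F' \<subseteq> F" "finite F'" "?E \<subseteq> ideal_gen ?T F'"
      using ideal_gen_finite_set[OF T, of ?E F] by auto
    \<comment> \<open>Otherwise the finite set \<open>F'\<close>, which generates all of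
      \<open>?E\<close>, would generate \<open>F\<close>, contrary to \<open>notfg\<close>.\<close>
    then have "\<not> F \<subseteq> ideal_gen ?T ?E"
      using notfg ideal_gen_trans[OF T F'(3)] by blast
    then obtain f where f: "f \<in> F" "f \<notin> ideal_gen ?T ?E" by auto
    then obtain p where "p \<in> polys_over S" "poly p x = f" using F by (auto simp: adjoin_def)
    then have "p \<in> C Q N" using f ideal_gen_base[OF T] by (auto simp: C_def)
    then show "\<exists>r. r \<in> C Q N \<and> (\<forall>p\<in>C Q N. degree r \<le> degree p)"
      using ex_has_least_nat[of "\<lambda>p. p \<in> C Q N" p degree] by auto
  qed
  then obtain Q where Q: "\<And>N. Q N \<in> C Q N" "\<And>N p. p \<in> C Q N \<Longrightarrow> degree (Q N) \<le> degree p"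
    by blast
  \<comment> \<open>So \<open>Q N\<close> was already a candidate at every earlier stage
    \<open>i\<close>. This gives \<open>degree (Q i) \<le> degree (Q N)\<close>, as
    \<open>lift_leading_coeff\<close> demands.\<close>
  have anti: "C Q N \<subseteq> C Q i" if "i < N" for i N
  proof -
    have "(\<lambda>i. poly (Q i) x) ` {..<i} \<subseteq> (\<lambda>i. poly (Q i) x) ` {..<N}" using that by auto
    from ideal_gen_mono[OF T this] show ?thesis by (auto simp: C_def)
  qed
  have "lead_coeff (Q i) \<in> S" for i using Q(1)[of i] by (auto simp: C_def polys_over_def)
  then obtain N where N: "lead_coeff (Q N) \<in> ideal_gen S ((\<lambda>i. lead_coeff (Q i)) ` {..<N})"
    using noetherian_sequence[OF assms, of "\<lambda>i. lead_coeff (Q i)"] by auto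
  let ?I = "ideal_gen ?T ((\<lambda>i. poly (Q i) x) ` {..<N})"
  have "Q i \<in> polys_over S \<and> degree (Q i) \<le> degree (Q N)" if "i \<in> {..<N}" for i
    using Q anti[of i N] that by (auto simp: C_def)
  from lift_leading_coeff[OF S this N, of x] obtain W
    where W: "W \<in> polys_over S" "degree W \<le> degree (Q N)" "coeff W (degree (Q N)) = lead_coeff (Q N)"
      "poly W x \<in> ?I" by auto
  \<comment> \<open>\<open>W\<close> has its value in \<open>?I\<close> and cancels the top
    coefficient of \<open>Q N\<close>. Hence \<open>?V\<close> is still a candidate, yet of smaller
    degree unless it is 0, and 0 is not a candidate either.\<close>
  let ?V = "Q N - W"
  have QF: "(\<lambda>i. poly (Q i) x) ` {..<N} \<subseteq> ideal_gen ?T F" using Q by (auto simp: C_def)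
  have V_notin: "poly ?V x \<notin> ?I"
  proof
    assume "poly ?V x \<in> ?I"
    from ideal_gen_add[OF this W(4)] show False using Q(1)[of N] by (auto simp: C_def)
  qed
  have "?V \<in> C Q N"
    using V_notin W Q(1)[of N] ideal_gen_trans[OF T QF]
    by (auto simp: C_def intro!: subring_diff[OF P] ideal_gen_diff[OF T])
  then have "degree (Q N) \<le> degree ?V" using Q(2) by auto
  moreover have "degree ?V \<le> degree (Q N)" using W by (auto intro: degree_diff_le)
  ultimately have "lead_coeff ?V = 0" using W by (simp add: antisym)
  then have "?V = 0" by (simp only: leading_coeff_0_iff)
  then show False using V_notin ideal_gen.zero by (metis poly_0)
qed

section \<open>Extension of homomorphisms into an algebraically closed field\<close>

text \<open>A homomorphism is a total function of which only the values on \<open>S\<close> matter;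
  extending it to a larger subring means passing to another total function.\<close>

definition hom_on :: "'b::comm_ring_1 set \<Rightarrow> ('b \<Rightarrow> 'c::comm_ring_1) \<Rightarrow> bool" where
  "hom_on S \<sigma> \<longleftrightarrow> \<sigma> 1 = 1 \<and>
     (\<forall>x\<in>S. \<forall>y\<in>S. \<sigma> (x + y) = \<sigma> x + \<sigma> y \<and> \<sigma> (x * y) = \<sigma> x * \<sigma> y)"

lemma hom_on_one: "hom_on S \<sigma> \<Longrightarrow> \<sigma> 1 = 1"
  and hom_on_add: "hom_on S \<sigma> \<Longrightarrow> x \<in> S \<Longrightarrow> y \<in> S \<Longrightarrow> \<sigma> (x + y) = \<sigma> x + \<sigma> y"
  and hom_on_mult: "hom_on S \<sigma> \<Longrightarrow> x \<in> S \<Longrightarrow> y \<in> S \<Longrightarrow> \<sigma> (x * y) = \<sigma> x * \<sigma> y"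
  by (auto simp: hom_on_def)

lemma hom_on_zero:
  assumes "is_subring S" "hom_on S \<sigma>"
  shows "\<sigma> 0 = 0"
  using hom_on_add[OF assms(2), of 0 0] assms(1) by (simp add: subring_zero)

lemma hom_on_diff:
  assumes "is_subring S" "hom_on S \<sigma>" "x \<in> S" "y \<in> S"
  shows "\<sigma> (x - y) = \<sigma> x - \<sigma> y"
  using hom_on_add[OF assms(2), of "x - y" y] assms by (simp add: subring_diff)

lemma hom_on_sum:
  assumes "is_subring S" "hom_on S \<sigma>" "\<And>i. i \<in> I \<Longrightarrow> f i \<in> S"
  shows "\<sigma> (sum f I) = (\<Sum>i\<in>I. \<sigma> (f i))"
  using assms(3)
  by (induction I rule: infinite_finite_induct)
    (auto simp: hom_on_zero[OF assms(1,2)] hom_on_add[OF assms(2)] subring_sum[OF assms(1)])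

lemma hom_on_prod:
  assumes "is_subring S" "hom_on S \<sigma>" "\<And>i. i \<in> I \<Longrightarrow> f i \<in> S"
  shows "\<sigma> (prod f I) = (\<Prod>i\<in>I. \<sigma> (f i))"
  using assms(3)
  by (induction I rule: infinite_finite_induct)
    (auto simp: hom_on_one[OF assms(2)] hom_on_mult[OF assms(2)] subring_prod[OF assms(1)])

lemma hom_on_map_poly:
  assumes S: "is_subring S" and \<sigma>: "hom_on S \<sigma>" and p: "p \<in> polys_over S" and q: "q \<in> polys_over S"
  shows "map_poly \<sigma> (p + q) = map_poly \<sigma> p + map_poly \<sigma> q"
    and "map_poly \<sigma> (p - q) = map_poly \<sigma> p - map_poly \<sigma> q"
    and "map_poly \<sigma> (p * q) = map_poly \<sigma> p * map_poly \<sigma> q"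
proof -
  note [simp] = coeff_map_poly hom_on_zero[OF S \<sigma>]
  have c: "coeff p i \<in> S" "coeff q i \<in> S" for i using p q by (auto simp: polys_over_def)
  show "map_poly \<sigma> (p + q) = map_poly \<sigma> p + map_poly \<sigma> q"
    by (rule poly_eqI) (simp add: hom_on_add[OF \<sigma>] c)
  show "map_poly \<sigma> (p - q) = map_poly \<sigma> p - map_poly \<sigma> q"
    by (rule poly_eqI) (simp add: hom_on_diff[OF S \<sigma>] c)
  show "map_poly \<sigma> (p * q) = map_poly \<sigma> p * map_poly \<sigma> q"
    by (rule poly_eqI)
      (simp add: coeff_mult hom_on_sum[OF S \<sigma>] hom_on_mult[OF \<sigma>] c subring_mult[OF S])
qed

lemma map_poly_monom_hom_on:
  assumes "is_subring S" "hom_on S \<sigma>"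
  shows "map_poly \<sigma> (monom c k) = monom (\<sigma> c) k"
  by (rule poly_eqI) (simp add: coeff_map_poly hom_on_zero[OF assms])

text \<open>The hypothesis on \<open>t\<close> says that sending \<open>x\<close> to
  \<open>t\<close> respects every polynomial relation of \<open>x\<close> over \<open>S\<close>,
  which is what makes the extension well defined.\<close>

lemma hom_on_extend:
  fixes \<sigma> :: "'b::comm_ring_1 \<Rightarrow> 'c::comm_ring_1"
  assumes S: "is_subring S" and \<sigma>: "hom_on S \<sigma>"
    and t: "\<And>h. h \<in> polys_over S \<Longrightarrow> poly h x = 0 \<Longrightarrow> poly (map_poly \<sigma> h) t = 0"
  shows "\<exists>\<tau>. hom_on (adjoin S x) \<tau> \<and> (\<forall>h\<in>polys_over S. \<tau> (poly h x) = poly (map_poly \<sigma> h) t)"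
proof -
  note P = is_subring_polys_over[OF S]
  \<comment> \<open>\<open>SOME\<close> picks an arbitrary representative. Two of them differ by a
    polynomial vanishing at \<open>x\<close>, so by the hypothesis on \<open>t\<close> the value
    does not depend on the choice.\<close>
  define \<tau> where "\<tau> y = poly (map_poly \<sigma> (SOME h. h \<in> polys_over S \<and> poly h x = y)) t" for y
  have \<tau>: "\<tau> (poly h x) = poly (map_poly \<sigma> h) t" if h: "h \<in> polys_over S" for h
  proof -
    define g where "g = (SOME g. g \<in> polys_over S \<and> poly g x = poly h x)"
    have g: "g \<in> polys_over S" "poly g x = poly h x"
      using someI[of "\<lambda>g. g \<in> polys_over S \<and> poly g x = poly h x" h] h by (auto simp: g_def)
    then have "poly (map_poly \<sigma> (g - h)) t = 0"
      using h by (intro t subring_diff[OF P]) auto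
    then show ?thesis using hom_on_map_poly(2)[OF S \<sigma> g(1) h] by (simp add: \<tau>_def g_def)
  qed
  have "\<tau> 1 = 1"
    using \<tau>[OF monom_polys_over[OF S, of 1 0]] S
    by (simp add: subring_one map_poly_monom_hom_on[OF S \<sigma>] hom_on_one[OF \<sigma>] poly_monom)
  moreover have "\<tau> (poly g x + poly h x) = \<tau> (poly g x) + \<tau> (poly h x)"
    "\<tau> (poly g x * poly h x) = \<tau> (poly g x) * \<tau> (poly h x)"
    if "g \<in> polys_over S" "h \<in> polys_over S" for g h
    using \<tau>[OF subring_add[OF P that]] \<tau>[OF subring_mult[OF P that]] \<tau>[OF that(1)] \<tau>[OF that(2)]
      hom_on_map_poly[OF S \<sigma> that] by auto
  ultimately have "hom_on (adjoin S x) \<tau>" by (auto simp: hom_on_def adjoin_def)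
  with \<tau> show ?thesis by blast
qed

section \<open>Evaluation, pseudo-division and minimal polynomials over a subring\<close>

lemma poly_in_subring:
  assumes "is_subring S" "p \<in> polys_over S" "t \<in> S"
  shows "poly p t \<in> S"
  using assms unfolding poly_altdef
  by (auto simp: polys_over_def intro!: subring_sum subring_mult subring_power)

lemma hom_on_power:
  assumes "is_subring S" "hom_on S \<sigma>" "x \<in> S"
  shows "\<sigma> (x ^ k) = \<sigma> x ^ k"
  by (induction k) (auto simp: hom_on_one[OF assms(2)] hom_on_mult[OF assms(2)] subring_power assms)

lemma hom_on_poly:
  assumes S: "is_subring S" and \<sigma>: "hom_on S \<sigma>" and p: "p \<in> polys_over S" and t: "t \<in> S"
  shows "\<sigma> (poly p t) = poly (map_poly \<sigma> p) (\<sigma> t)"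
proof -
  have c: "coeff p i \<in> S" for i using p by (auto simp: polys_over_def)
  have "\<sigma> (poly p t) = (\<Sum>i\<le>degree p. \<sigma> (coeff p i) * \<sigma> t ^ i)"
    unfolding poly_altdef using c t
    by (simp add: hom_on_sum[OF S \<sigma>] hom_on_mult[OF \<sigma>] hom_on_power[OF S \<sigma>]
        subring_mult[OF S] subring_power[OF S])
  also have "\<dots> = (\<Sum>i\<le>degree p. coeff (map_poly \<sigma> p) i * \<sigma> t ^ i)"
    by (simp add: coeff_map_poly hom_on_zero[OF S \<sigma>])
  also have "\<dots> = poly (map_poly \<sigma> p) (\<sigma> t)"
  proof -
    \<comment> \<open>\<open>\<sigma>\<close> may kill leading coefficients, so
      \<open>degree p\<close> is only an upper bound for the degree of the image.\<close>
    have "degree (map_poly \<sigma> p) \<le> degree p"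
      by (rule degree_le) (simp add: coeff_map_poly hom_on_zero[OF S \<sigma>] coeff_eq_0)
    from arg_cong[OF poly_as_sum_of_monoms'[OF this], of "\<lambda>q. poly q (\<sigma> t)"]
    show ?thesis by (simp add: poly_sum poly_monom)
  qed
  finally show ?thesis .
qed

text \<open>The leading coefficient of \<open>q\<close> need not be invertible in \<open>S\<close>;
  multiplying \<open>p\<close> beforehand by a power of it, as a constant polynomial
  \<open>monom _ 0\<close>, replaces the division.\<close>

lemma polys_over_pseudo_division:
  fixes p q :: "'a::idom poly"
  assumes S: "is_subring S" and p: "p \<in> polys_over S" and q: "q \<in> polys_over S" "q \<noteq> 0"
  shows "\<exists>k. \<exists>u\<in>polys_over S. \<exists>r\<in>polys_over S.
           monom (lead_coeff q ^ k) 0 * p = q * u + r \<and> (r = 0 \<or> degree r < degree q)"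
  using p
proof (induction "degree p" arbitrary: p rule: less_induct)
  case less
  note P = is_subring_polys_over[OF S]
  let ?a = "lead_coeff q"
  show ?case
  proof (cases "p = 0 \<or> degree p < degree q")
    case True
    then show ?thesis
      using less.prems subring_zero[OF P]
      by (intro exI[of _ 0] bexI[of _ 0] bexI[of _ p]) (auto simp: monom_0 one_pCons[symmetric])
  next
    case False
    let ?m = "monom (lead_coeff p) (degree p - degree q)"
    define p' where "p' = monom ?a 0 * p - ?m * q"
    have aS: "?a \<in> S" "lead_coeff p \<in> S" using q less.prems by (auto simp: polys_over_def)
    have m: "?m \<in> polys_over S" using monom_polys_over[OF S aS(2)] .
    have p': "p' \<in> polys_over S"
      using less.prems q m monom_polys_over[OF S aS(1)]
      unfolding p'_def by (intro subring_diff[OF P] subring_mult[OF P])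
    have "degree p' \<le> degree p"
      unfolding p'_def using False degree_mult_le[of ?m q] degree_monom_le[of "lead_coeff p" "degree p - degree q"]
      by (intro degree_diff_le) (auto simp: monom_0)
    moreover have "coeff p' (degree p) = 0"
      using False by (simp add: p'_def coeff_monom_mult monom_0)
    ultimately have "p' = 0 \<or> degree p' < degree p"
      by (metis le_neq_implies_less leading_coeff_0_iff)
    then show ?thesis
    proof
      assume "p' = 0"
      then show ?thesis
        using m subring_zero[OF P]
        by (intro exI[of _ 1] bexI[of _ ?m] bexI[of _ 0]) (auto simp: p'_def mult.commute)
    next
      assume "degree p' < degree p"
      from less.hyps[OF this p'] obtain k u r where
        ur: "u \<in> polys_over S" "r \<in> polys_over S" "monom (?a ^ k) 0 * p' = q * u + r"
          "r = 0 \<or> degree r < degree q" by blast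
      have "monom (?a ^ Suc k) 0 * p = monom (?a ^ k) 0 * (p' + ?m * q)"
        by (simp add: p'_def monom_0 mult.commute)
      also have "\<dots> = q * (u + monom (?a ^ k) 0 * ?m) + r"
        using ur(3) by (simp add: algebra_simps)
      finally show ?thesis
        using ur m aS monom_polys_over[OF S subring_power[OF S aS(1)]]
        by (intro exI[of _ "Suc k"] bexI[of _ "u + monom (?a ^ k) 0 * ?m"] bexI[of _ r])
          (auto intro!: subring_add[OF P] subring_mult[OF P])
    qed
  qed
qed

text \<open>The leading coefficient is not normalised to 1, since it may fail to be a unit of
  \<open>S\<close>.\<close>

definition is_minpoly :: "'a::comm_ring_1 set \<Rightarrow> 'a \<Rightarrow> 'a poly \<Rightarrow> bool" where
  "is_minpoly S x p \<longleftrightarrow> p \<in> polys_over S \<and> p \<noteq> 0 \<and> poly p x = 0 \<and>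
     (\<forall>h\<in>polys_over S. poly h x = 0 \<longrightarrow> degree h < degree p \<longrightarrow> h = 0)"

lemma ex_minpoly:
  assumes "h \<in> polys_over S" "h \<noteq> 0" "poly h x = 0"
  shows "\<exists>p. is_minpoly S x p"
  using ex_has_least_nat[of "\<lambda>h. h \<in> polys_over S \<and> h \<noteq> 0 \<and> poly h x = 0" h degree] assms
  unfolding is_minpoly_def by (meson leD)

text \<open>Among the polynomials whose value at \<open>x\<close> is a nonzero multiple of
  \<open>b\<close>, one of least degree is constant. If not, dividing \<open>p\<close> by it leaves
  a remainder of smaller degree whose value is again a multiple of \<open>b\<close>, hence 0; the
  remainder then vanishes, and the quotient is a nonzero relation of degree below that of
  \<open>p\<close>.\<close>

lemma minpoly_multiple_in_base:
  fixes b :: "'a::idom"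
  assumes S: "is_subring S" and p: "is_minpoly S x p" and b: "b \<in> adjoin S x" "b \<noteq> 0"
  shows "\<exists>e\<in>adjoin S x. b * e \<in> S \<and> b * e \<noteq> 0"
proof -
  note P = is_subring_polys_over[OF S] and T = is_subring_adjoin[OF S, of x]
  note pD = p[unfolded is_minpoly_def]
  define M where "M = {q \<in> polys_over S. poly q x \<noteq> 0 \<and> (\<exists>e\<in>adjoin S x. poly q x = b * e)}"
  obtain g where "g \<in> polys_over S" "poly g x = b" using b by (auto simp: adjoin_def)
  then have "g \<in> M" using b subring_one[OF T] by (auto simp: M_def intro: bexI[of _ 1])
  then obtain q where q: "q \<in> M" "\<And>r. r \<in> M \<Longrightarrow> degree q \<le> degree r"
    using ex_has_least_nat[of "\<lambda>q. q \<in> M" g degree] by auto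
  then obtain e where e: "q \<in> polys_over S" "poly q x \<noteq> 0" "e \<in> adjoin S x" "poly q x = b * e"
    by (auto simp: M_def)
  then have q0: "q \<noteq> 0" by auto
  \<comment> \<open>Pseudo-division by \<open>p\<close> changes the value at \<open>x\<close> only
    by a nonzero factor from \<open>S\<close>, so the remainder belongs to \<open>M\<close> as
    well.\<close>
  have lt: "degree q < degree p"
  proof -
    obtain k u r where ur: "u \<in> polys_over S" "r \<in> polys_over S"
      "monom (lead_coeff p ^ k) 0 * q = p * u + r" "r = 0 \<or> degree r < degree p"
      using polys_over_pseudo_division[OF S e(1), of p] pD by blast
    have "poly p x = 0" using pD by blast
    with arg_cong[OF ur(3), of "\<lambda>h. poly h x"]
    have "poly r x = lead_coeff p ^ k * poly q x" by (simp add: poly_monom)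
    moreover have "lead_coeff p ^ k \<in> adjoin S x"
      using subset_adjoin[OF S] pD by (auto simp: polys_over_def intro!: subring_power[OF T])
    ultimately have "r \<in> M" "r \<noteq> 0"
      using ur e pD unfolding M_def
      by (auto intro!: bexI[of _ "lead_coeff p ^ k * e"] subring_mult[OF T] simp: ac_simps)
    then show ?thesis using q(2)[of r] ur(4) by auto
  qed
  have "degree q = 0"
  proof (rule ccontr)
    assume pos: "degree q \<noteq> 0"
    obtain k u r where ur: "u \<in> polys_over S" "r \<in> polys_over S"
      "monom (lead_coeff q ^ k) 0 * p = q * u + r" "r = 0 \<or> degree r < degree q"
      using polys_over_pseudo_division[OF S _ e(1) q0, of p] pD by blast
    have rx: "poly r x = - (poly q x * poly u x)"
      using pD arg_cong[OF ur(3), of "\<lambda>h. poly h x"] by (simp add: poly_monom eq_neg_iff_add_eq_0 add.commute)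
    have "r \<notin> M" using q(2)[of r] ur(4) pos by auto
    moreover have "poly r x = b * (- (e * poly u x))" using rx e by (simp add: algebra_simps)
    moreover have "- (e * poly u x) \<in> adjoin S x"
    proof -
      have "poly u x \<in> adjoin S x" using ur(1) by (auto simp: adjoin_def)
      then show ?thesis by (rule subring_uminus[OF T subring_mult[OF T e(3)]])
    qed
    ultimately have rx0: "poly r x = 0" using ur(2) unfolding M_def by blast
    then have "r = 0" using pD ur lt by auto
    have u0: "poly u x = 0" using rx rx0 e by simp
    have eq: "monom (lead_coeff q ^ k) 0 * p = q * u" using ur \<open>r = 0\<close> by simp
    then have "u \<noteq> 0" using pD q0 by (auto simp: monom_eq_0_iff)
    have "degree p = degree q + degree u"
      using arg_cong[OF eq, of degree] \<open>u \<noteq> 0\<close> q0 by (simp add: degree_mult_eq monom_0)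
    then have "degree u < degree p" using pos by simp
    then show False using pD ur(1) u0 \<open>u \<noteq> 0\<close> by blast
  qed
  then obtain c where "q = [:c:]" by (rule degree_eq_zeroE)
  then have "poly q x = coeff q 0" by simp
  then show ?thesis using e by (intro bexI[of _ e]) (auto simp: polys_over_def)
qed

text \<open>Asking for a subring suffices: the roots of the linear polynomials
  \<open>c X - 1\<close> supply inverses, so such a \<open>K\<close> is an algebraically closed
  field.\<close>

definition alg_closed_subset :: "'a::field set \<Rightarrow> bool" where
  "alg_closed_subset K \<longleftrightarrow> is_subring K \<and>
     (\<forall>p\<in>polys_over K. degree p > 0 \<longrightarrow> (\<exists>t\<in>K. poly p t = 0))"

text \<open>As in Euclid's proof for primes: over a finite \<open>K\<close>, one plus the product of
  all \<open>X - c\<close> takes the value 1 at every element of \<open>K\<close>.\<close>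

lemma alg_closed_subset_infinite:
  assumes "alg_closed_subset K"
  shows "infinite K"
proof
  assume fin: "finite K"
  have K: "is_subring K" using assms by (simp add: alg_closed_subset_def)
  note P = is_subring_polys_over[OF K]
  let ?q = "\<Prod>c\<in>K. [:- c, 1:]"
  have "[:- c, 1:] \<in> polys_over K" if "c \<in> K" for c
    using that K by (auto simp: polys_over_def coeff_pCons subring_uminus subring_one subring_zero split: nat.split)
  then have "?q + 1 \<in> polys_over K"
    by (intro subring_add[OF P] subring_prod[OF P] subring_one[OF P])
  moreover have "degree ?q = card K"
    by (subst degree_prod_sum_eq) auto
  then have "degree ?q > 0" using fin subring_one[OF K] by (auto simp: card_gt_0_iff)
  then have "degree (?q + 1) > 0" by (subst degree_add_eq_left) auto
  ultimately obtain t where "t \<in> K" "poly (?q + 1) t = 0"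
    using assms unfolding alg_closed_subset_def by blast
  then show False using fin prod_zero[of K "(-) t"] by (auto simp: poly_prod)
qed

text \<open>
  This form is inherited by \<open>adjoin S x\<close>: if \<open>x\<close> is transcendental over \<open>S\<close>, it may be sent to
  almost every element of \<open>K\<close>; if it is algebraic, \<open>b\<close> is replaced by a multiple in \<open>S\<close> times the
  leading coefficient of a minimal polynomial of \<open>x\<close>.
\<close>

definition separated_by_points :: "'a::field set \<Rightarrow> 'a set \<Rightarrow> bool" where
  "separated_by_points K S \<longleftrightarrow>
     (\<forall>b\<in>S. b \<noteq> 0 \<longrightarrow>
        (\<exists>\<sigma>. hom_on S \<sigma> \<and> (\<forall>c\<in>K. \<sigma> c = c) \<and> \<sigma> ` S \<subseteq> K \<and> \<sigma> b \<noteq> 0))"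

lemma hom_on_extend_into:
  assumes S: "is_subring S" and \<sigma>: "hom_on S \<sigma>" "\<forall>c\<in>K. \<sigma> c = c" "\<sigma> ` S \<subseteq> K"
    and K: "is_subring K" "K \<subseteq> S" and "t \<in> K"
    and "\<And>h. h \<in> polys_over S \<Longrightarrow> poly h x = 0 \<Longrightarrow> poly (map_poly \<sigma> h) t = 0"
  shows "\<exists>\<tau>. hom_on (adjoin S x) \<tau> \<and> (\<forall>c\<in>K. \<tau> c = c) \<and> \<tau> ` adjoin S x \<subseteq> K \<and>
           (\<forall>h\<in>polys_over S. \<tau> (poly h x) = poly (map_poly \<sigma> h) t)"
proof -
  obtain \<tau> where \<tau>: "hom_on (adjoin S x) \<tau>"
    "\<And>h. h \<in> polys_over S \<Longrightarrow> \<tau> (poly h x) = poly (map_poly \<sigma> h) t"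
    using hom_on_extend[OF S \<sigma>(1) assms(8)] by blast
  have "\<tau> c = c" if "c \<in> K" for c
    using \<tau>(2)[of "monom c 0"] that K \<sigma>
    by (auto simp: monom_polys_over[OF S] map_poly_monom_hom_on[OF S \<sigma>(1)] poly_monom)
  moreover have "map_poly \<sigma> h \<in> polys_over K" if "h \<in> polys_over S" for h
    using that \<sigma> by (auto simp: polys_over_def coeff_map_poly hom_on_zero[OF S \<sigma>(1)])
  then have "\<tau> ` adjoin S x \<subseteq> K"
    using \<tau>(2) \<open>t \<in> K\<close> by (auto simp: adjoin_def intro!: poly_in_subring[OF K(1)])
  ultimately show ?thesis using \<tau> by blast
qed

lemma separated_by_points_adjoin:
  assumes K: "alg_closed_subset K" "K \<subseteq> S" and S: "is_subring S" "separated_by_points K S"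
  shows "separated_by_points K (adjoin S x)"
  unfolding separated_by_points_def
proof (intro ballI impI)
  fix b assume b: "b \<in> adjoin S x" "b \<noteq> 0"
  have Ksub: "is_subring K" using K by (simp add: alg_closed_subset_def)
  note P = is_subring_polys_over[OF S(1)]
  show "\<exists>\<tau>. hom_on (adjoin S x) \<tau> \<and> (\<forall>c\<in>K. \<tau> c = c) \<and> \<tau> ` adjoin S x \<subseteq> K \<and> \<tau> b \<noteq> 0"
  proof (cases "\<exists>h\<in>polys_over S. h \<noteq> 0 \<and> poly h x = 0")
    case False
    obtain g where g: "g \<in> polys_over S" "poly g x = b" using b by (auto simp: adjoin_def)
    then have "lead_coeff g \<in> S" "lead_coeff g \<noteq> 0" using b by (auto simp: polys_over_def)
    then obtain \<sigma> where \<sigma>: "hom_on S \<sigma>" "\<forall>c\<in>K. \<sigma> c = c" "\<sigma> ` S \<subseteq> K" "\<sigma> (lead_coeff g) \<noteq> 0"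
      using S unfolding separated_by_points_def by blast
    then have "map_poly \<sigma> g \<noteq> 0"
      by (metis coeff_0 coeff_map_poly hom_on_zero[OF S(1)])
    then have "\<not> K \<subseteq> {t. poly (map_poly \<sigma> g) t = 0}"
      using alg_closed_subset_infinite[OF K(1)] poly_roots_finite finite_subset by blast
    then obtain t where t: "t \<in> K" "poly (map_poly \<sigma> g) t \<noteq> 0" by blast
    have "poly (map_poly \<sigma> h) t = 0" if "h \<in> polys_over S" "poly h x = 0" for h
      using that False by auto
    with hom_on_extend_into[OF S(1) \<sigma>(1-3) Ksub K(2) t(1), of x] show ?thesis using g t by metis
  next
    case True
    then obtain p where p: "is_minpoly S x p" using ex_minpoly by blast
    note pD = p[unfolded is_minpoly_def]
    obtain e where e: "e \<in> adjoin S x" "b * e \<in> S" "b * e \<noteq> 0"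
      using minpoly_multiple_in_base[OF S(1) p b] by blast
    let ?a = "lead_coeff p"
    have a: "?a \<in> S" "?a \<noteq> 0" using pD by (auto simp: polys_over_def)
    \<comment> \<open>The factor \<open>?a\<close> keeps the degree of
      \<open>map_poly \<sigma> p\<close> from dropping, so that it has a root in \<open>K\<close>;
      the factor \<open>b * e\<close> keeps the image of \<open>b\<close> away from 0.\<close>
    then have "?a * (b * e) \<in> S" "?a * (b * e) \<noteq> 0" using e by (auto intro!: subring_mult[OF S(1)])
    then obtain \<sigma> where \<sigma>: "hom_on S \<sigma>" "\<forall>c\<in>K. \<sigma> c = c" "\<sigma> ` S \<subseteq> K" "\<sigma> (?a * (b * e)) \<noteq> 0"
      using S(2) unfolding separated_by_points_def by blast
    then have \<sigma>a: "\<sigma> ?a \<noteq> 0" and \<sigma>be: "\<sigma> (b * e) \<noteq> 0"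
      using hom_on_mult[OF \<sigma>(1) a(1) e(2)] by auto
    have [simp]: "\<sigma> 0 = 0" by (rule hom_on_zero[OF S(1) \<sigma>(1)])
    have "degree p \<noteq> 0"
    proof
      assume "degree p = 0"
      then obtain c where "p = [:c:]" by (rule degree_eq_zeroE)
      then show False using pD by simp
    qed
    moreover have "coeff (map_poly \<sigma> p) (degree p) \<noteq> 0" using \<sigma>a by (simp add: coeff_map_poly)
    then have "degree p \<le> degree (map_poly \<sigma> p)" by (rule le_degree)
    ultimately have "degree (map_poly \<sigma> p) > 0" by linarith
    moreover have "map_poly \<sigma> p \<in> polys_over K"
      using pD \<sigma>(3) by (auto simp: polys_over_def coeff_map_poly)
    ultimately obtain t where t: "t \<in> K" "poly (map_poly \<sigma> p) t = 0"
      using K(1) unfolding alg_closed_subset_def by blast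
    \<comment> \<open>By minimality of \<open>p\<close> the pseudo-division of \<open>h\<close>
      leaves no remainder. After applying \<open>\<sigma>\<close>, the nonzero power of
      \<open>\<sigma> ?a\<close> cancels, and the root \<open>t\<close> of the image of
      \<open>p\<close> is a root of the image of \<open>h\<close>.\<close>
    have root: "poly (map_poly \<sigma> h) t = 0" if h: "h \<in> polys_over S" "poly h x = 0" for h
    proof -
      obtain k u r where ur: "u \<in> polys_over S" "r \<in> polys_over S"
        "monom (?a ^ k) 0 * h = p * u + r" "r = 0 \<or> degree r < degree p"
        using polys_over_pseudo_division[OF S(1) h(1), of p] pD by blast
      have "poly r x = 0"
        using pD h arg_cong[OF ur(3), of "\<lambda>h. poly h x"] by simp
      then have "r = 0" using pD ur by blast
      then have eq: "monom (?a ^ k) 0 * h = p * u" using ur by simp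
      have M: "monom (?a ^ k) 0 \<in> polys_over S"
        using a by (intro monom_polys_over[OF S(1)] subring_power[OF S(1)])
      from eq have "monom (\<sigma> ?a ^ k) 0 * map_poly \<sigma> h = map_poly \<sigma> p * map_poly \<sigma> u"
        using hom_on_map_poly(3)[OF S(1) \<sigma>(1) M h(1)] hom_on_map_poly(3)[OF S(1) \<sigma>(1) _ ur(1), of p] pD a
        by (simp add: map_poly_monom_hom_on[OF S(1) \<sigma>(1)] hom_on_power[OF S(1) \<sigma>(1)])
      from arg_cong[OF this, of "\<lambda>h. poly h t"] show ?thesis using t \<sigma>a by (simp add: poly_monom)
    qed
    have "\<exists>\<tau>. hom_on (adjoin S x) \<tau> \<and> (\<forall>c\<in>K. \<tau> c = c) \<and> \<tau> ` adjoin S x \<subseteq> K \<and>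
        (\<forall>h\<in>polys_over S. \<tau> (poly h x) = poly (map_poly \<sigma> h) t)"
      by (rule hom_on_extend_into[OF S(1) \<sigma>(1-3) Ksub K(2) t(1)]) (rule root)
    then obtain \<tau> where \<tau>: "hom_on (adjoin S x) \<tau>" "\<forall>c\<in>K. \<tau> c = c" "\<tau> ` adjoin S x \<subseteq> K"
      "\<forall>h\<in>polys_over S. \<tau> (poly h x) = poly (map_poly \<sigma> h) t" by (elim exE conjE)
    have "\<tau> (b * e) = \<sigma> (b * e)"
      using bspec[OF \<tau>(4) monom_polys_over[OF S(1) e(2), of 0]]
      by (simp add: poly_monom map_poly_monom_hom_on[OF S(1) \<sigma>(1)])
    then have "\<tau> b \<noteq> 0" using \<sigma>be hom_on_mult[OF \<tau>(1) b(1) e(1)] by auto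
    with \<tau>(1-3) show ?thesis by (intro exI conjI)
  qed
qed

text \<open>The identity separates \<open>K\<close>, and each adjunction preserves separation. This
  is the Nullstellensatz for finitely generated \<open>K\<close>-algebras inside the large
  field.\<close>

lemma separated_by_points_foldl_adjoin:
  assumes K: "alg_closed_subset K"
  shows "separated_by_points K (foldl adjoin K xs)"
proof -
  have sub: "is_subring K" using K by (simp add: alg_closed_subset_def)
  have "separated_by_points K K" unfolding separated_by_points_def
    by (intro ballI impI exI[of _ id]) (auto simp: hom_on_def)
  then show ?thesis
    using foldl_adjoin(4)[OF sub, of "\<lambda>R. K \<subseteq> R \<and> separated_by_points K R" xs]
      separated_by_points_adjoin[OF K] subset_adjoin by blast
qed

section \<open>The algebraic closure of the prime field\<close>

text \<open>In characteristic \<open>p > 0\<close> and for \<open>r > 0\<close> these are the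
  elements of the field of order \<open>p^r\<close>. For \<open>r = 0\<close> the exponent is 1 and
  every element is fixed, so \<open>prime_field_closure\<close> has to exclude that case.\<close>

definition frobenius_fixed_elements :: "nat \<Rightarrow> 'a::field set" where
  "frobenius_fixed_elements r = {x. x ^ (CHAR('a) ^ r) = x}"

definition prime_field_closure :: "'a::field set" where
  "prime_field_closure = (\<Union>r\<in>{0<..}. frobenius_fixed_elements r)"

lemma hom_on_frobenius:
  assumes "CHAR('a::field) > 0"
  shows "hom_on S (\<lambda>x::'a. x ^ (CHAR('a) ^ r))"
  using freshmans_dream'[OF prime_CHAR_semidom[OF assms] refl]
  by (auto simp: hom_on_def power_mult_distrib)

lemma is_subring_UNIV: "is_subring UNIV"
  by (simp add: is_subring_def)

lemma frobenius_inj: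
  fixes x y :: "'a::field"
  assumes "CHAR('a) > 0" "x ^ (CHAR('a) ^ r) = y ^ (CHAR('a) ^ r)"
  shows "x = y"
  using hom_on_diff[OF is_subring_UNIV hom_on_frobenius[OF assms(1)], of x y r] assms by simp

lemma is_subring_frobenius_fixed_elements:
  assumes "CHAR('a::field) > 0"
  shows "is_subring (frobenius_fixed_elements r :: 'a set)"
  using hom_on_diff[OF is_subring_UNIV hom_on_frobenius[OF assms(1)], of _ _ r]
  by (auto simp: is_subring_def frobenius_fixed_elements_def power_mult_distrib)

lemma finite_frobenius_fixed_elements:
  assumes "CHAR('a::field) > 0" "r > 0"
  shows "finite (frobenius_fixed_elements r :: 'a set)"
proof -
  let ?q = "CHAR('a) ^ r" and ?f = "monom 1 (CHAR('a) ^ r) - monom 1 1 :: 'a poly"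
  have "CHAR('a) > 1" using prime_CHAR_semidom[OF assms(1)] prime_gt_1_nat by blast
  then have "?q > 1" using assms(2) by (rule one_less_power)
  then have "coeff ?f ?q \<noteq> 0" by simp
  then have "?f \<noteq> 0" by (metis coeff_0)
  from poly_roots_finite[OF this] show ?thesis
    by (simp add: frobenius_fixed_elements_def poly_monom)
qed

lemma frobenius_fixed_elements_dvd:
  assumes "r dvd s"
  shows "frobenius_fixed_elements r \<subseteq> (frobenius_fixed_elements s :: 'a::field set)"
proof
  fix x :: 'a assume "x \<in> frobenius_fixed_elements r"
  then have x: "x ^ (CHAR('a) ^ r) = x" by (simp add: frobenius_fixed_elements_def)
  have "x ^ ((CHAR('a) ^ r) ^ k) = x" for k
    by (induction k) (auto simp: x power_mult)
  then show "x \<in> frobenius_fixed_elements s"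
    using assms by (auto simp: frobenius_fixed_elements_def power_mult)
qed

text \<open>The fixed fields are directed by divisibility of exponents: those for \<open>r\<close>
  and \<open>s\<close> both lie in the one for \<open>r * s\<close>.\<close>

lemma finite_subset_prime_field_closure:
  assumes "finite X" "X \<subseteq> (prime_field_closure :: 'a::field set)"
  shows "\<exists>r>0. X \<subseteq> frobenius_fixed_elements r"
  using assms
proof (induction X)
  case empty
  show ?case by (auto intro: exI[of _ 1])
next
  case (insert x X)
  then obtain r s where "r > 0" "X \<subseteq> frobenius_fixed_elements r"
    "s > 0" "x \<in> frobenius_fixed_elements s" by (auto simp: prime_field_closure_def)
  then show ?case
    using frobenius_fixed_elements_dvd[of r "r * s", where 'a = 'a]
      frobenius_fixed_elements_dvd[of s "r * s", where 'a = 'a]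
    by (intro exI[of _ "r * s"]) auto
qed

lemma is_subring_prime_field_closure:
  assumes "CHAR('a::field) > 0"
  shows "is_subring (prime_field_closure :: 'a set)"
proof -
  have "x - y \<in> prime_field_closure \<and> x * y \<in> prime_field_closure"
    if xy: "x \<in> prime_field_closure" "y \<in> prime_field_closure" for x y :: 'a
  proof -
    obtain r where "r > 0" "{x, y} \<subseteq> frobenius_fixed_elements r"
      using finite_subset_prime_field_closure[of "{x, y}"] xy by auto
    then show ?thesis
      using is_subring_frobenius_fixed_elements[OF assms, of r]
      by (auto simp: prime_field_closure_def is_subring_def)
  qed
  moreover have "1 \<in> (prime_field_closure :: 'a set)"
    by (auto simp: prime_field_closure_def frobenius_fixed_elements_def)
  ultimately show ?thesis by (simp add: is_subring_def)
qed

lemma inverse_prime_field_closure: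
  "x \<in> prime_field_closure \<Longrightarrow> inverse x \<in> (prime_field_closure :: 'a::field set)"
  by (auto simp: prime_field_closure_def frobenius_fixed_elements_def power_inverse)

text \<open>The coefficients of \<open>p\<close> are fixed by one power map \<open>x^q\<close>,
  which therefore maps roots to roots. The orbit of a root in the large field is finite, and
  injectivity of Frobenius turns a coincidence in the orbit into a return to its start, so the root
  is fixed by a power of Frobenius.\<close>

lemma alg_closed_prime_field_closure:
  assumes "CHAR('a::alg_closed_field) > 0"
  shows "alg_closed_subset (prime_field_closure :: 'a set)"
  unfolding alg_closed_subset_def
proof (intro conjI ballI impI)
  fix p :: "'a poly" assume p: "p \<in> polys_over prime_field_closure" "0 < degree p"
  have "finite (coeff p ` {..degree p})" "coeff p ` {..degree p} \<subseteq> prime_field_closure"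
    using p by (auto simp: polys_over_def)
  then obtain r where r: "r > 0" "coeff p ` {..degree p} \<subseteq> frobenius_fixed_elements r"
    using finite_subset_prime_field_closure by blast
  let ?q = "CHAR('a) ^ r"
  let ?F = "\<lambda>x::'a. x ^ ?q"
  have q0: "?q > 0" using assms by simp
  have "coeff p i \<in> frobenius_fixed_elements r" for i
    using r q0 by (cases "i \<le> degree p") (auto simp: frobenius_fixed_elements_def coeff_eq_0)
  then have fix_p: "map_poly ?F p = p"
    using q0 by (intro poly_eqI) (auto simp: coeff_map_poly frobenius_fixed_elements_def)
  obtain t where t: "poly p t = 0" using p alg_closed_imp_poly_has_root by blast
  have root: "poly p (t ^ (?q ^ i)) = 0" for i
  proof (induction i)
    case (Suc i)
    have "poly p ((t ^ (?q ^ i)) ^ ?q) = (poly p (t ^ (?q ^ i))) ^ ?q"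
      using hom_on_poly[OF is_subring_UNIV hom_on_frobenius[OF assms], of p "t ^ (?q ^ i)" r]
      by (simp add: fix_p polys_over_def)
    then have "poly p ((t ^ (?q ^ i)) ^ ?q) = 0" using Suc q0 by (simp add: power_0_left)
    moreover have "?q ^ Suc i = ?q ^ i * ?q" by simp
    ultimately show ?case by (simp only: power_mult)
  qed (use t in simp)
  have "finite {x. poly p x = 0}" using p by (intro poly_roots_finite) auto
  moreover have "range (\<lambda>i. t ^ (?q ^ i)) \<subseteq> {x. poly p x = 0}" using root by auto
  ultimately have "\<not> inj (\<lambda>i. t ^ (?q ^ i))"
    using finite_imageD infinite_UNIV_nat finite_subset by blast
  then obtain i j where ij: "i < j" "t ^ (?q ^ i) = t ^ (?q ^ j)"
    unfolding inj_def by (metis linorder_neqE_nat)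
  have "?q ^ j = ?q ^ (j - i) * ?q ^ i" using ij by (simp flip: power_add)
  then have "(t ^ (?q ^ (j - i))) ^ (?q ^ i) = t ^ (?q ^ i)" using ij by (simp add: power_mult)
  then have "(t ^ (CHAR('a) ^ (r * (j - i)))) ^ (CHAR('a) ^ (r * i)) = t ^ (CHAR('a) ^ (r * i))"
    by (simp add: power_mult)
  from frobenius_inj[OF assms this] have "t \<in> frobenius_fixed_elements (r * (j - i))"
    by (simp add: frobenius_fixed_elements_def)
  then have "t \<in> prime_field_closure" using r ij by (auto simp: prime_field_closure_def)
  then show "\<exists>t\<in>prime_field_closure. poly p t = 0" using t by auto
qed (rule is_subring_prime_field_closure[OF assms])

section \<open>Regular functions and the Zariski topology\<close>

lemma carrier_GL_iff: "A \<in> carrier (GL n) \<longleftrightarrow> A \<in> carrier_mat n n \<and> det A \<noteq> 0"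
  using det_non_zero_imp_unit[of A n "()"] unit_imp_det_non_zero[of A n "()"]
  by (auto simp: GL_def units_of_def Units_def ring_mat_simps)

lemma mult_GL [simp]: "mult (GL n) = (*)"
  by (simp add: GL_def units_of_def ring_mat_simps)

lemma one_GL [simp]: "one (GL n) = 1\<^sub>m n"
  by (simp add: GL_def units_of_def ring_mat_simps)

lemma group_GL: "Group.group (GL n :: 'a::field mat monoid)"
proof -
  interpret R: ring "ring_mat TYPE('a) n ()" by (rule ring_mat)
  show ?thesis unfolding GL_def by (rule R.units_group)
qed

text \<open>The adjugate formula is what exhibits the entries of the inverse as regular
  functions.\<close>

lemma inv_GL:
  fixes A :: "'a::field mat"
  assumes "A \<in> carrier (GL n)"
  shows "inv\<^bsub>GL n\<^esub> A = inverse (det A) \<cdot>\<^sub>m adj_mat A"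
proof -
  interpret group "GL n :: 'a mat monoid" by (rule group_GL)
  let ?B = "inverse (det A) \<cdot>\<^sub>m adj_mat A"
  have A: "A \<in> carrier_mat n n" "det A \<noteq> 0" using assms by (auto simp: carrier_GL_iff)
  have B: "?B \<in> carrier_mat n n" using adj_mat(1)[OF A(1)] by simp
  have BA: "?B * A = 1\<^sub>m n"
  proof -
    have "?B * A = inverse (det A) \<cdot>\<^sub>m (det A \<cdot>\<^sub>m 1\<^sub>m n)"
      using A adj_mat[OF A(1)] by (simp add: mult_smult_assoc_mat[of _ n n _ n])
    also have "\<dots> = 1\<^sub>m n" using A(2) by (intro eq_matI) auto
    finally show ?thesis .
  qed
  then have "det ?B * det A = 1" using det_mult[OF B A(1)] by simp
  then have "?B \<in> carrier (GL n)" using B by (auto simp: carrier_GL_iff)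
  then show ?thesis using BA assms by (intro inv_equality) auto
qed

text \<open>Products of functions turn intersections of principal open sets into principal open
  sets, so these form a basis. A basic neighbourhood of \<open>B\<close> outside \<open>X\<close>
  yields the function.\<close>

lemma closedin_zariski_separation:
  fixes X :: "'a::field mat set"
  assumes X: "closedin (zariski n) X" and B: "B \<in> carrier (GL n)" "B \<notin> X"
  shows "\<exists>f\<in>regular_funs UNIV n. (\<forall>A\<in>X. f A = 0) \<and> f B \<noteq> 0"
proof -
  let ?D = "\<lambda>f::'a mat \<Rightarrow> 'a. {A \<in> carrier (GL n). f A \<noteq> 0}"
  have top: "topspace (zariski n) = (carrier (GL n) :: 'a mat set)"
  proof -
    have "(\<lambda>_. 1 :: 'a) \<in> regular_funs UNIV n" by (rule regular_funs.const) simp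
    from imageI[OF this, of ?D] have "carrier (GL n) \<in> ?D ` regular_funs UNIV n" by simp
    then have "carrier (GL n) \<subseteq> \<Union> (?D ` regular_funs UNIV n)" by (rule Union_upper)
    moreover have "\<Union> (?D ` regular_funs UNIV n) \<subseteq> carrier (GL n)" by (rule Union_least) auto
    ultimately show ?thesis
      unfolding zariski_def topology_generated_by_topspace by (rule subset_antisym[rotated])
  qed
  have basis: "\<forall>A\<in>U. \<exists>f\<in>regular_funs UNIV n. f A \<noteq> 0 \<and> ?D f \<subseteq> U"
    if "generate_topology_on (?D ` regular_funs UNIV n) U" for U :: "'a mat set"
    using that
  proof induction
    case (Int a b)
    show ?case
    proof
      fix A assume "A \<in> a \<inter> b"
      then have A: "A \<in> a" "A \<in> b" by auto
      from bspec[OF Int.IH(1) A(1)] bspec[OF Int.IH(2) A(2)]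
      obtain f g where "f \<in> regular_funs UNIV n" "f A \<noteq> 0" "?D f \<subseteq> a"
        "g \<in> regular_funs UNIV n" "g A \<noteq> 0" "?D g \<subseteq> b" by (elim bexE conjE)
      then show "\<exists>f\<in>regular_funs UNIV n. f A \<noteq> 0 \<and> ?D f \<subseteq> a \<inter> b"
        by (intro bexI[of _ "\<lambda>A. f A * g A"]) (auto intro: regular_funs.mult)
    qed
  next
    case (UN K)
    show ?case
    proof
      fix A assume "A \<in> \<Union> K"
      then obtain k where k: "k \<in> K" "A \<in> k" by (rule UnionE)
      from bspec[OF UN.IH[OF k(1)] k(2)]
      obtain f where f: "f \<in> regular_funs UNIV n" "f A \<noteq> 0" "?D f \<subseteq> k" by (elim bexE conjE)
      from f(3) have "?D f \<subseteq> \<Union> K" by (rule order_trans[OF _ Union_upper[OF k(1)]])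
      with f show "\<exists>f\<in>regular_funs UNIV n. f A \<noteq> 0 \<and> ?D f \<subseteq> \<Union> K" by (intro bexI[of _ f] conjI)
    qed
  qed auto
  have "generate_topology_on (?D ` regular_funs UNIV n) (carrier (GL n) - X)"
    using X top by (simp add: closedin_def zariski_def openin_topology_generated_by_iff)
  from basis[OF this] B obtain f where
    "f \<in> regular_funs UNIV n" "f B \<noteq> 0" "?D f \<subseteq> carrier (GL n) - X" by blast
  moreover have "X \<subseteq> carrier (GL n)" using X top by (simp add: closedin_def)
  ultimately show ?thesis by blast
qed

text \<open>The constants form a field, hence a Noetherian ring, and the finitely many functions in
  \<open>xs\<close> generate the rest. Operations are pointwise on total functions, so the relations
  hold at every matrix, invertible or not.\<close>

lemma regular_funs_noetherian:
  fixes F :: "('a::field mat \<Rightarrow> 'a) set"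
  assumes "F \<subseteq> regular_funs UNIV n"
  shows "\<exists>F'\<subseteq>F. finite F' \<and> (\<forall>A. (\<forall>f\<in>F'. f A = 0) \<longrightarrow> (\<forall>f\<in>F. f A = 0))"
proof -
  define S :: "('a mat \<Rightarrow> 'a) set" where "S = range (\<lambda>c _. c)"
  have S: "is_subring S"
    by (auto simp: is_subring_def S_def one_fun_def fun_diff_def times_fun_def)
  have "noetherian S"
    unfolding noetherian_def
  proof (intro allI impI)
    fix F :: "('a mat \<Rightarrow> 'a) set" assume F: "F \<subseteq> S"
    show "\<exists>F'\<subseteq>F. finite F' \<and> F \<subseteq> ideal_gen S F'"
    proof (cases "F \<subseteq> {0}")
      case True
      then show ?thesis using ideal_gen.zero by (intro exI[of _ "{}"]) auto
    next
      case False
      then obtain f where f: "f \<in> F" "f \<noteq> 0" by auto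
      then obtain c where c: "f = (\<lambda>_. c)" "c \<noteq> 0" using F by (auto simp: S_def zero_fun_def)
      have "g \<in> ideal_gen S {f}" if g: "g \<in> F" for g
      proof -
        obtain d where d: "g = (\<lambda>_. d)" using g F by (auto simp: S_def)
        then have "g = (\<lambda>_. d * inverse c) * f + 0"
          using c by (auto simp: times_fun_def fun_eq_iff)
        moreover have "(\<lambda>_. d * inverse c) \<in> S" by (auto simp: S_def)
        ultimately show ?thesis using ideal_gen.step ideal_gen.zero by (metis singletonI)
      qed
      then show ?thesis using f by (intro exI[of _ "{f}"]) auto
    qed
  qed
  define xs :: "('a mat \<Rightarrow> 'a) list" where
    "xs = (\<lambda>A. inverse (det A)) # map (\<lambda>(i, j) A. A $$ (i, j)) (List.product [0..<n] [0..<n])"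
  define T where "T = foldl adjoin S xs"
  have T: "is_subring T" "S \<subseteq> T" "set xs \<subseteq> T" "noetherian T"
    using foldl_adjoin[OF S noetherian_adjoin \<open>noetherian S\<close>, of xs] by (auto simp: T_def)
  have "f \<in> T" if "f \<in> regular_funs UNIV n" for f
    using that
  proof induction
    case (const c)
    then show ?case using T(2) by (auto simp: S_def)
  next
    case (entry i j)
    then have "(\<lambda>A. A $$ (i, j)) \<in> set xs" by (force simp: xs_def)
    then show ?case using T(3) by auto
  next
    case inv_det
    then show ?case using T(3) by (auto simp: xs_def)
  next
    case (add f g)
    then show ?case using subring_add[OF T(1)] by (simp add: plus_fun_def)
  next
    case (mult f g)
    then show ?case using subring_mult[OF T(1)] by (simp add: times_fun_def)
  qed
  then have "F \<subseteq> T" using assms by auto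
  from T(4)[unfolded noetherian_def, rule_format, OF this]
  obtain F' where F': "F' \<subseteq> F" "finite F'" "F \<subseteq> ideal_gen T F'" by (elim exE conjE)
  have "f A = 0" if "\<forall>f\<in>F'. f A = 0" "f \<in> ideal_gen T F'" for f A
    using that(2)
  proof induction
    case zero
    show ?case by (simp add: zero_fun_def)
  next
    case (step s f a)
    then show ?case using that(1) by (simp add: plus_fun_def times_fun_def)
  qed
  with F' show ?thesis by (intro exI[of _ F'] conjI allI impI ballI) auto
qed

text \<open>Entries of products and inverses match elements of \<open>regular_funs\<close> only at
  matrices of the right size or invertible ones; hence agreement on \<open>X\<close> in place of
  equality.\<close>

definition regular_on :: "nat \<Rightarrow> 'a::field mat set \<Rightarrow> ('a mat \<Rightarrow> 'a) \<Rightarrow> bool" where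
  "regular_on n X h \<longleftrightarrow> (\<exists>f\<in>regular_funs UNIV n. \<forall>A\<in>X. h A = f A)"

lemma regular_on_const: "regular_on n X (\<lambda>_. c)"
  unfolding regular_on_def by (rule bexI[OF _ regular_funs.const]) auto

lemma regular_on_add: "regular_on n X f \<Longrightarrow> regular_on n X g \<Longrightarrow> regular_on n X (\<lambda>A. f A + g A)"
  unfolding regular_on_def using regular_funs.add by fastforce

lemma regular_on_mult: "regular_on n X f \<Longrightarrow> regular_on n X g \<Longrightarrow> regular_on n X (\<lambda>A. f A * g A)"
  unfolding regular_on_def using regular_funs.mult by fastforce

lemma regular_on_sum: "(\<And>i. i \<in> I \<Longrightarrow> regular_on n X (f i)) \<Longrightarrow> regular_on n X (\<lambda>A. \<Sum>i\<in>I. f i A)"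
  by (induction I rule: infinite_finite_induct) (auto intro: regular_on_const regular_on_add)

lemma regular_on_prod: "(\<And>i. i \<in> I \<Longrightarrow> regular_on n X (f i)) \<Longrightarrow> regular_on n X (\<lambda>A. \<Prod>i\<in>I. f i A)"
  by (induction I rule: infinite_finite_induct) (auto intro: regular_on_const regular_on_mult)

lemma regular_on_cong: "regular_on n X f \<Longrightarrow> (\<And>A. A \<in> X \<Longrightarrow> g A = f A) \<Longrightarrow> regular_on n X g"
  by (auto simp: regular_on_def)

lemma regular_on_det:
  assumes "\<And>A. A \<in> X \<Longrightarrow> \<psi> A \<in> carrier_mat k k"
    and "\<And>i j. i < k \<Longrightarrow> j < k \<Longrightarrow> regular_on n X (\<lambda>A. \<psi> A $$ (i, j))"
  shows "regular_on n X (\<lambda>A. det (\<psi> A))"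
proof -
  have "regular_on n X (\<lambda>A. \<Sum>p | p permutes {0..<k}. of_int (sign p) * (\<Prod>i = 0..<k. \<psi> A $$ (i, p i)))"
    by (intro regular_on_sum regular_on_mult regular_on_const regular_on_prod assms(2))
      (auto dest: permutes_in_image)
  moreover have "det (\<psi> A) = (\<Sum>p | p permutes {0..<k}. of_int (sign p) * (\<Prod>i = 0..<k. \<psi> A $$ (i, p i)))"
    if "A \<in> X" for A
    using assms(1)[OF that] unfolding det_def by (simp only: carrier_matD if_True simp_thms)
  ultimately show ?thesis by (rule regular_on_cong)
qed

text \<open>The last clause is what composition with the generator \<open>inverse (det A)\<close>
  requires; regular entries alone would only make the determinant regular.\<close>

definition regular_GL_map :: "nat \<Rightarrow> 'a::field mat set \<Rightarrow> nat \<Rightarrow> ('a mat \<Rightarrow> 'a mat) \<Rightarrow> bool" where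
  "regular_GL_map n X k \<psi> \<longleftrightarrow> (\<forall>A\<in>X. \<psi> A \<in> carrier (GL k)) \<and>
     (\<forall>i<k. \<forall>j<k. regular_on n X (\<lambda>A. \<psi> A $$ (i, j))) \<and>
     regular_on n X (\<lambda>A. inverse (det (\<psi> A)))"

lemma regular_on_comp:
  assumes \<psi>: "regular_GL_map n X k \<psi>" and f: "f \<in> regular_funs UNIV k"
  shows "regular_on n X (\<lambda>A. f (\<psi> A))"
  using f
  by induction
    (use \<psi> in \<open>auto simp: regular_GL_map_def intro: regular_on_const regular_on_add regular_on_mult\<close>)

lemma regular_GL_map_const: "B \<in> carrier (GL k) \<Longrightarrow> regular_GL_map n X k (\<lambda>_. B)"
  by (auto simp: regular_GL_map_def intro: regular_on_const)

lemma regular_GL_map_id: "X \<subseteq> carrier (GL n) \<Longrightarrow> regular_GL_map n X n (\<lambda>A. A)"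
  by (auto simp: regular_GL_map_def regular_on_def intro: regular_funs.intros)

lemma regular_GL_map_mult:
  fixes \<psi> \<chi> :: "'a::field mat \<Rightarrow> 'a mat"
  assumes "regular_GL_map n X k \<psi>" "regular_GL_map n X k \<chi>"
  shows "regular_GL_map n X k (\<lambda>A. \<psi> A * \<chi> A)"
proof -
  interpret group "GL k :: 'a mat monoid" by (rule group_GL)
  have c: "\<psi> A \<in> carrier_mat k k" "\<chi> A \<in> carrier_mat k k" if "A \<in> X" for A
    using assms that by (auto simp: regular_GL_map_def carrier_GL_iff)
  have "regular_on n X (\<lambda>A. (\<psi> A * \<chi> A) $$ (i, j))" if ij: "i < k" "j < k" for i j
  proof -
    have "regular_on n X (\<lambda>A. \<Sum>l = 0..<k. \<psi> A $$ (i, l) * \<chi> A $$ (l, j))"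
      using assms ij by (intro regular_on_sum regular_on_mult) (auto simp: regular_GL_map_def)
    moreover have "(\<psi> A * \<chi> A) $$ (i, j) = (\<Sum>l = 0..<k. \<psi> A $$ (i, l) * \<chi> A $$ (l, j))"
      if "A \<in> X" for A
      using c[OF that] ij by (auto simp: scalar_prod_def)
    ultimately show ?thesis by (rule regular_on_cong)
  qed
  moreover have "regular_on n X (\<lambda>A. inverse (det (\<psi> A * \<chi> A)))"
  proof -
    have "regular_on n X (\<lambda>A. inverse (det (\<psi> A)) * inverse (det (\<chi> A)))"
      using assms by (intro regular_on_mult) (auto simp: regular_GL_map_def)
    moreover have "inverse (det (\<psi> A * \<chi> A)) = inverse (det (\<psi> A)) * inverse (det (\<chi> A))"
      if "A \<in> X" for A
      using det_mult[OF c[OF that]] by simp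
    ultimately show ?thesis by (rule regular_on_cong)
  qed
  moreover have "\<psi> A * \<chi> A \<in> carrier (GL k)" if "A \<in> X" for A
    using assms that m_closed[of "\<psi> A" "\<chi> A"] by (auto simp: regular_GL_map_def)
  ultimately show ?thesis by (simp add: regular_GL_map_def)
qed

lemma det_inv_GL:
  fixes A :: "'a::field mat"
  assumes "A \<in> carrier (GL n)"
  shows "inverse (det (inv\<^bsub>GL n\<^esub> A)) = det A"
proof -
  interpret group "GL n :: 'a mat monoid" by (rule group_GL)
  have "inv\<^bsub>GL n\<^esub> A \<in> carrier_mat n n" "A \<in> carrier_mat n n"
    using inv_closed[OF assms] assms by (auto simp: carrier_GL_iff)
  from det_mult[OF this] have "det (inv\<^bsub>GL n\<^esub> A) * det A = 1" using l_inv[OF assms] by simp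
  then show ?thesis by (metis inverse_inverse_eq inverse_unique mult.commute)
qed

lemma regular_GL_map_inv:
  fixes X :: "'a::field mat set"
  assumes X: "X \<subseteq> carrier (GL n)"
  shows "regular_GL_map n X n (\<lambda>A. inv\<^bsub>GL n\<^esub> A)"
proof -
  interpret group "GL n :: 'a mat monoid" by (rule group_GL)
  have dim: "A \<in> carrier_mat n n" if "A \<in> X" for A using X that by (auto simp: carrier_GL_iff)
  have entry: "regular_on n X (\<lambda>A. A $$ (i, j))" if "i < n" "j < n" for i j
    using regular_GL_map_id[OF X] that by (simp add: regular_GL_map_def)
  have "regular_on n X (\<lambda>A. (inv\<^bsub>GL n\<^esub> A) $$ (i, j))" if ij: "i < n" "j < n" for i j
  proof -
    have "regular_on n X (\<lambda>A. det (mat_delete A j i))"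
    proof (rule regular_on_det)
      fix A assume "A \<in> X"
      then show "mat_delete A j i \<in> carrier_mat (n - 1) (n - 1)"
        using dim[of A] by (auto simp: mat_delete_def)
    next
      fix a b assume ab: "a < n - 1" "b < n - 1"
      \<comment> \<open>Deleting row \<open>j\<close> and column \<open>i\<close> shifts the later
        indices by one. The roles of \<open>i\<close> and \<open>j\<close> are exchanged because the
        adjugate is the transposed cofactor matrix.\<close>
      let ?a = "if a < j then a else Suc a" and ?b = "if b < i then b else Suc b"
      have "regular_on n X (\<lambda>A. A $$ (?a, ?b))" using ab by (intro entry) auto
      moreover have "mat_delete A j i $$ (a, b) = A $$ (?a, ?b)" if "A \<in> X" for A
        using dim[OF that] ab by (auto simp: mat_delete_def)
      ultimately show "regular_on n X (\<lambda>A. mat_delete A j i $$ (a, b))"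
        by (rule regular_on_cong)
    qed
    moreover have "regular_on n X (\<lambda>A. inverse (det A))"
      using regular_GL_map_id[OF X] by (simp add: regular_GL_map_def)
    ultimately have "regular_on n X (\<lambda>A. inverse (det A) * ((- 1) ^ (j + i) * det (mat_delete A j i)))"
      by (intro regular_on_mult regular_on_const)
    moreover have "(inv\<^bsub>GL n\<^esub> A) $$ (i, j) = inverse (det A) * ((- 1) ^ (j + i) * det (mat_delete A j i))"
      if "A \<in> X" for A
      using dim[OF that] ij X that adj_mat(1)[OF dim[OF that]]
      by (simp add: inv_GL subset_iff adj_mat_def cofactor_def)
    ultimately show ?thesis by (rule regular_on_cong)
  qed
  moreover have "regular_on n X (\<lambda>A. inverse (det (inv\<^bsub>GL n\<^esub> A)))"
  proof -
    have "regular_on n X (\<lambda>A. det A)" by (rule regular_on_det[OF dim entry])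
    moreover have "inverse (det (inv\<^bsub>GL n\<^esub> A)) = det A" if "A \<in> X" for A
      using det_inv_GL X that by blast
    ultimately show ?thesis by (rule regular_on_cong)
  qed
  ultimately show ?thesis using X by (auto simp: regular_GL_map_def)
qed

section \<open>Density of points over the closure of the prime field\<close>

lemma det_hom_on:
  assumes R: "is_subring R" and \<sigma>: "hom_on R \<sigma>"
    and A: "A \<in> carrier_mat n n" "elements_mat A \<subseteq> R"
  shows "det A \<in> R" "det (map_mat \<sigma> A) = \<sigma> (det A)"
proof -
  have entry: "A $$ (i, j) \<in> R" if "i < n" "j < n" for i j
    using elements_matI[OF A(1) that refl] A(2) by blast
  have sgn: "of_int (sign p) \<in> R" "\<sigma> (of_int (sign p)) = of_int (sign p)" for p :: "nat \<Rightarrow> nat"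
    using hom_on_diff[OF R \<sigma> subring_zero[OF R] subring_one[OF R]] R
    by (auto simp: sign_def subring_one subring_uminus hom_on_one[OF \<sigma>] hom_on_zero[OF R \<sigma>])
  have perm: "p i < n" if "p permutes {0..<n}" "i < n" for p i
    using permutes_in_image[OF that(1), of i] that(2) by simp
  have pr: "(\<Prod>i = 0..<n. A $$ (i, p i)) \<in> R" if "p permutes {0..<n}" for p
    by (rule subring_prod[OF R]) (auto intro: entry perm[OF that])
  show "det A \<in> R"
    unfolding det_def'[OF A(1)]
    by (intro subring_sum[OF R] subring_mult[OF R] sgn pr) simp
  have "\<sigma> (det A) = (\<Sum>p | p permutes {0..<n}. \<sigma> (of_int (sign p) * (\<Prod>i = 0..<n. A $$ (i, p i))))"
    unfolding det_def'[OF A(1)]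
    by (rule hom_on_sum[OF R \<sigma>]) (auto intro!: subring_mult[OF R] sgn pr)
  also have "\<dots> = (\<Sum>p | p permutes {0..<n}. of_int (sign p) * (\<Prod>i = 0..<n. map_mat \<sigma> A $$ (i, p i)))"
  proof (rule sum.cong[OF refl])
    fix p assume "p \<in> {p. p permutes {0..<n}}"
    then have p: "p permutes {0..<n}" by simp
    have "\<sigma> (\<Prod>i = 0..<n. A $$ (i, p i)) = (\<Prod>i = 0..<n. \<sigma> (A $$ (i, p i)))"
      by (rule hom_on_prod[OF R \<sigma>]) (auto intro: entry perm[OF p])
    also have "\<dots> = (\<Prod>i = 0..<n. map_mat \<sigma> A $$ (i, p i))"
      using A(1) perm[OF p] by (intro prod.cong) auto
    finally show "\<sigma> (of_int (sign p) * (\<Prod>i = 0..<n. A $$ (i, p i))) =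
        of_int (sign p) * (\<Prod>i = 0..<n. map_mat \<sigma> A $$ (i, p i))"
      by (simp add: hom_on_mult[OF \<sigma> sgn(1) pr[OF p]] sgn)
  qed
  also have "\<dots> = det (map_mat \<sigma> A)"
    using A(1) by (intro det_def'[symmetric]) simp
  finally show "det (map_mat \<sigma> A) = \<sigma> (det A)" by simp
qed

lemma inverse_hom_on:
  fixes \<sigma> :: "'a::field \<Rightarrow> 'b::field"
  assumes "hom_on R \<sigma>" "x \<in> R" "inverse x \<in> R" "x \<noteq> 0"
  shows "inverse (\<sigma> x) = \<sigma> (inverse x)" "\<sigma> x \<noteq> 0"
proof -
  have "\<sigma> x * \<sigma> (inverse x) = 1"
    using hom_on_mult[OF assms(1-3)] hom_on_one[OF assms(1)] assms(4) by simp
  then show "inverse (\<sigma> x) = \<sigma> (inverse x)" "\<sigma> x \<noteq> 0" by (auto simp: inverse_unique)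
qed

text \<open>The value of \<open>f\<close> arises by ring operations in \<open>R\<close> from
  coefficients fixed by \<open>\<sigma>\<close>, the entries of \<open>A\<close> and
  \<open>inverse (det A)\<close>. With the identity as \<open>\<sigma>\<close> the lemma also shows
  that values stay in \<open>R\<close>.\<close>

lemma regular_funs_hom_on:
  fixes \<sigma> :: "'a::field \<Rightarrow> 'a"
  assumes R: "is_subring R" and \<sigma>: "hom_on R \<sigma>" and K: "K \<subseteq> R" "\<And>c. c \<in> K \<Longrightarrow> \<sigma> c = c"
    and A: "A \<in> carrier (GL n)" "elements_mat A \<subseteq> R" "inverse (det A) \<in> R"
    and f: "f \<in> regular_funs K n"
  shows "f A \<in> R \<and> f (map_mat \<sigma> A) = \<sigma> (f A)"
proof -
  have A': "A \<in> carrier_mat n n" "det A \<noteq> 0" using A(1) by (auto simp: carrier_GL_iff)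
  note det = det_hom_on[OF R \<sigma> A'(1) A(2)]
  show ?thesis
    using f
  proof induction
    case (entry i j)
    then show ?case using A'(1) elements_matI[OF A'(1) entry refl] A(2) by auto
  next
    case inv_det
    show ?case using inverse_hom_on(1)[OF \<sigma> det(1) A(3) A'(2)] A(3) det(2) by simp
  qed (use K in \<open>auto simp: subring_add[OF R] subring_mult[OF R] hom_on_add[OF \<sigma>] hom_on_mult[OF \<sigma>]\<close>)
qed

lemma closedin_zariski_subset: "closedin (zariski n) X \<Longrightarrow> X \<subseteq> carrier (GL n)"
  by (auto simp: closedin_def zariski_def topology_generated_by_topspace)

lemma closedin_zariskiI:
  fixes X :: "'a::field mat set"
  assumes "closedin (zariski n) X" "B \<in> carrier (GL n)"
    and "\<And>f. f \<in> regular_funs UNIV n \<Longrightarrow> \<forall>A\<in>X. f A = 0 \<Longrightarrow> f B = 0"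
  shows "B \<in> X"
  using closedin_zariski_separation[OF assms(1,2)] assms(3) by blast

text \<open>\<open>defined_over\<close> provides equations of \<open>X\<close> with coefficients in
  \<open>K\<close>, and a homomorphism fixing \<open>K\<close> maps solutions to solutions. This is
  applied to specialisations into the small field and to Frobenius.\<close>

lemma map_mat_hom_on_in_variety:
  fixes \<sigma> :: "'a::field \<Rightarrow> 'a"
  assumes R: "is_subring R" and \<sigma>: "hom_on R \<sigma>" and K: "K \<subseteq> R" "\<And>c. c \<in> K \<Longrightarrow> \<sigma> c = c"
    and X: "closedin (zariski n) X" "defined_over K n X"
    and A: "A \<in> X" "elements_mat A \<subseteq> R" "inverse (det A) \<in> R"
  shows "map_mat \<sigma> A \<in> X"
proof (rule closedin_zariskiI[OF X(1)])
  have A1: "A \<in> carrier (GL n)" using closedin_zariski_subset[OF X(1)] A(1) by blast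
  then have A': "A \<in> carrier_mat n n" "det A \<noteq> 0" by (auto simp: carrier_GL_iff)
  note det = det_hom_on[OF R \<sigma> A'(1) A(2)]
  \<comment> \<open>Needed before the equations: the expansion of \<open>f\<close> through functions
    over \<open>K\<close> is asserted only at invertible matrices.\<close>
  show B: "map_mat \<sigma> A \<in> carrier (GL n)"
    using A'(1) inverse_hom_on(2)[OF \<sigma> det(1) A(3) A'(2)] det(2) by (simp add: carrier_GL_iff)
  fix f :: "'a mat \<Rightarrow> 'a" assume f: "f \<in> regular_funs UNIV n" "\<forall>A\<in>X. f A = 0"
  from X(2)[unfolded defined_over_def, rule_format, OF f(1)] f(2) obtain F c where
    F: "F \<subseteq> {h \<in> regular_funs K n. \<forall>A\<in>X. h A = 0}"
      "\<forall>A\<in>carrier (GL n). f A = (\<Sum>h\<in>F. c h * h A)" by auto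
  have "h (map_mat \<sigma> A) = 0" if "h \<in> F" for h
  proof -
    have h: "h \<in> regular_funs K n" "h A = 0" using F(1) that A(1) by auto
    have "h (map_mat \<sigma> A) = \<sigma> (h A)"
      using regular_funs_hom_on[OF R \<sigma> K A1 A(2,3) h(1)] by simp
    then show ?thesis using h hom_on_zero[OF R \<sigma>] by simp
  qed
  then have "(\<Sum>h\<in>F. c h * h (map_mat \<sigma> A)) = 0" by (intro sum.neutral) simp
  then show "f (map_mat \<sigma> A) = 0" using F(2) B by simp
qed

lemma prime_field_subset_subring:
  assumes "is_subring S"
  shows "prime_field \<subseteq> S"
proof -
  have "of_nat k \<in> S" for k
    by (induction k) (auto simp: subring_zero subring_one subring_add assms)
  then show ?thesis by (auto simp: prime_field_def)
qed

definition points_over :: "'a::field set \<Rightarrow> 'a mat set \<Rightarrow> 'a mat set" where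
  "points_over K X = {A \<in> X. elements_mat A \<subseteq> K}"

lemma regular_funs_vanish_on_points_over:
  fixes X :: "'a::alg_closed_field mat set"
  assumes p: "CHAR('a) > 0" and X: "closedin (zariski n) X" "defined_over prime_field n X"
    and f: "f \<in> regular_funs prime_field_closure n" "\<And>B. B \<in> points_over prime_field_closure X \<Longrightarrow> f B = 0"
    and A: "A \<in> X"
  shows "f A = 0"
proof (rule ccontr)
  let ?K = "prime_field_closure :: 'a set"
  assume fA: "f A \<noteq> 0"
  note K = is_subring_prime_field_closure[OF p]
  have "finite (elements_mat A)" unfolding elements_mat_def by (rule finite_set)
  from finite_list[OF this] obtain xs where xs: "set xs = elements_mat A" by (rule exE)
  \<comment> \<open>Adjoining \<open>inverse (det A)\<close> keeps the values of regular functions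
    at \<open>A\<close> inside \<open>R\<close> and the specialised matrix invertible.\<close>
  define R where "R = foldl adjoin ?K (inverse (det A) # xs)"
  note adj = foldl_adjoin[OF K, of "\<lambda>_. True" "inverse (det A) # xs", OF TrueI TrueI, folded R_def]
  have R: "is_subring R" "?K \<subseteq> R" "inverse (det A) \<in> R" "elements_mat A \<subseteq> R"
    using adj(1-3) by (simp_all add: xs)
  have sep: "separated_by_points ?K R"
    unfolding R_def by (rule separated_by_points_foldl_adjoin[OF alg_closed_prime_field_closure[OF p]])
  have A': "A \<in> carrier (GL n)" using closedin_zariski_subset[OF X(1)] A by blast
  have "f A \<in> R"
    using regular_funs_hom_on[OF R(1) _ R(2) _ A' R(4,3) f(1), of "\<lambda>x. x"] by (simp add: hom_on_def)
  from sep[unfolded separated_by_points_def, rule_format, OF this fA]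
  obtain \<sigma> where \<sigma>: "hom_on R \<sigma>" "\<forall>c\<in>?K. \<sigma> c = c" "\<sigma> ` R \<subseteq> ?K" "\<sigma> (f A) \<noteq> 0"
    by (elim exE conjE)
  have F: "prime_field \<subseteq> ?K" by (rule prime_field_subset_subring[OF K])
  have "map_mat \<sigma> A \<in> X"
    by (rule map_mat_hom_on_in_variety[OF R(1) \<sigma>(1) _ _ X A R(4,3)]) (use F R(2) \<sigma>(2) in auto)
  moreover have "elements_mat (map_mat \<sigma> A) \<subseteq> ?K" 
    unfolding elements_mat_map using image_mono[OF R(4)] \<sigma>(3) by (rule order_trans)
  ultimately have "f (map_mat \<sigma> A) = 0" by (intro f(2)) (simp add: points_over_def)
  moreover have "f (map_mat \<sigma> A) = \<sigma> (f A)"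
    using regular_funs_hom_on[OF R(1) \<sigma>(1) R(2) _ A' R(4,3) f(1)] \<sigma>(2) by simp
  ultimately show False using \<sigma>(4) by simp
qed

text \<open>Sums concatenate and products expand pairwise. A list of pairs, not a finite set of
  functions, allows the same function to occur repeatedly.\<close>

lemma regular_funs_UNIV_span:
  fixes f :: "'a::field mat \<Rightarrow> 'a"
  assumes K: "is_subring K" and f: "f \<in> regular_funs UNIV n"
  shows "\<exists>ps. snd ` set ps \<subseteq> regular_funs K n \<and> (\<forall>A. f A = (\<Sum>(c, g)\<leftarrow>ps. c * g A))"
  using f
proof induction
  case (const c)
  show ?case
    by (rule exI[of _ "[(c, \<lambda>_. 1)]"]) (auto intro: regular_funs.const subring_one[OF K])
next
  case (entry i j)
  then show ?case by (intro exI[of _ "[(1, \<lambda>A. A $$ (i, j))]"]) (auto intro: regular_funs.entry)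
next
  case inv_det
  show ?case by (rule exI[of _ "[(1, \<lambda>A. inverse (det A))]"]) (auto intro: regular_funs.inv_det)
next
  case (add f g)
  then obtain ps qs where "snd ` set ps \<subseteq> regular_funs K n" "\<forall>A. f A = (\<Sum>(c, g)\<leftarrow>ps. c * g A)"
    "snd ` set qs \<subseteq> regular_funs K n" "\<forall>A. g A = (\<Sum>(c, g)\<leftarrow>qs. c * g A)" by (elim exE conjE)
  then show ?case by (intro exI[of _ "ps @ qs"]) auto
next
  case (mult f g)
  then obtain ps qs where ps: "snd ` set ps \<subseteq> regular_funs K n" "\<forall>A. f A = (\<Sum>(c, g)\<leftarrow>ps. c * g A)"
    and qs: "snd ` set qs \<subseteq> regular_funs K n" "\<forall>A. g A = (\<Sum>(c, g)\<leftarrow>qs. c * g A)" by (elim exE conjE)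
  let ?rs = "concat (map (\<lambda>(c, u). map (\<lambda>(d, v). (c * d, \<lambda>A. u A * v A)) qs) ps)"
  have reg: "u \<in> regular_funs K n" if "(c, u) \<in> set ps \<union> set qs" for c u
    using that ps(1) qs(1) by force
  then have "snd ` set ?rs \<subseteq> regular_funs K n"
    by (auto intro!: regular_funs.mult dest: reg[OF UnI1] reg[OF UnI2])
  moreover have "(\<Sum>(c, g)\<leftarrow>map (\<lambda>(d, v). (c * d, \<lambda>A. u A * v A)) qs. c * g A) =
      c * u A * (\<Sum>(c, g)\<leftarrow>qs. c * g A)" for c u and A :: "'a mat"
    by (induction qs) (auto simp: algebra_simps)
  then have "(\<Sum>(c, g)\<leftarrow>?rs. c * g A) = (\<Sum>(c, g)\<leftarrow>ps. c * g A) * (\<Sum>(c, g)\<leftarrow>qs. c * g A)" for A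
    by (induction ps) (auto simp: distrib_right)
  ultimately show ?case using ps(2) qs(2) by (intro exI[of _ ?rs]) simp
qed

lemma regular_funs_value_in_subfield:
  assumes "is_subring K" "\<And>x. x \<in> K \<Longrightarrow> inverse x \<in> K"
    and "A \<in> carrier (GL n)" "elements_mat A \<subseteq> K" "f \<in> regular_funs K n"
  shows "f A \<in> K"
proof -
  have id: "hom_on K (\<lambda>x. x)" by (simp add: hom_on_def)
  have "det A \<in> K" using det_hom_on(1)[OF assms(1) id _ assms(4)] assms(3) by (auto simp: carrier_GL_iff)
  then show ?thesis
    using regular_funs_hom_on[OF assms(1) id subset_refl _ assms(3,4) _ assms(5)] assms(2) by simp
qed

text \<open>\<open>regular_funs_vanish_on_points_over\<close> covers coefficients in the small
  field. A general \<open>f\<close> is a combination of such functions, and induction on the number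
  of terms reduces to that case.\<close>

lemma points_over_prime_field_closure_dense:
  fixes X :: "'a::alg_closed_field mat set"
  assumes p: "CHAR('a) > 0" and X: "closedin (zariski n) X" "defined_over prime_field n X"
    and f: "f \<in> regular_funs UNIV n" "\<And>B. B \<in> points_over prime_field_closure X \<Longrightarrow> f B = 0"
    and A: "A \<in> X"
  shows "f A = 0"
proof -
  let ?K = "prime_field_closure :: 'a set"
  note K = is_subring_prime_field_closure[OF p]
  have vanish: "(\<Sum>(c, g)\<leftarrow>ps. c * g A) = 0"
    if "snd ` set ps \<subseteq> regular_funs ?K n"
      "\<And>B. B \<in> points_over ?K X \<Longrightarrow> (\<Sum>(c, g)\<leftarrow>ps. c * g B) = 0" for ps
    using that
    \<comment> \<open>If some \<open>g\<close> of the list does not vanish at a point \<open>B\<close>, evaluating the sum at \<open>B\<close> expresses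
      its coefficient through the others with multipliers in the small field, so \<open>g\<close> is eliminated.\<close>
  proof (induction "length ps" arbitrary: ps rule: less_induct)
    case less
    show ?case
    proof (cases "\<forall>q\<in>set ps. \<forall>B\<in>points_over ?K X. snd q B = 0")
      case True
      have "snd q A = 0" if "q \<in> set ps" for q
      proof (rule regular_funs_vanish_on_points_over[OF p X _ _ A])
        show "snd q \<in> regular_funs ?K n" using that less.prems(1) by (auto simp: image_subset_iff)
      qed (use that True in auto)
      then have "map (\<lambda>(c, g). c * g A) ps = map (\<lambda>_. 0) ps" by (intro map_cong refl) (simp add: split_beta)
      then show ?thesis by (simp only: sum_list_0)
    next
      case False
      then obtain q B where q: "q \<in> set ps" "B \<in> points_over ?K X" "snd q B \<noteq> 0" by auto
      obtain c g where "q = (c, g)" by (rule prod.exhaust)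
      with q have cg: "(c, g) \<in> set ps" and B: "B \<in> points_over ?K X" "g B \<noteq> 0" by auto
      obtain ys zs where ps: "ps = ys @ (c, g) # zs" using split_list[OF cg] by (elim exE)
      define e where "e = (\<lambda>h. - (h B) * inverse (g B))"
      define qs where "qs = map (\<lambda>(d, h). (d, \<lambda>C. h C + e h * g C)) (ys @ zs)"
      have BG: "B \<in> carrier (GL n)" "elements_mat B \<subseteq> ?K"
        using B closedin_zariski_subset[OF X(1)] by (auto simp: points_over_def)
      have val: "h B \<in> ?K" if "h \<in> regular_funs ?K n" for h
        by (rule regular_funs_value_in_subfield[OF K inverse_prime_field_closure BG that])
      have reg: "g \<in> regular_funs ?K n" "snd ` set ys \<subseteq> regular_funs ?K n"
        "snd ` set zs \<subseteq> regular_funs ?K n" using less.prems(1) by (auto simp: ps)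
      have "e h \<in> ?K" if "h \<in> regular_funs ?K n" for h
        unfolding e_def using val[OF that] val[OF reg(1)]
        by (intro subring_mult[OF K] subring_uminus[OF K] inverse_prime_field_closure)
      then have upd: "(\<lambda>C. h C + e h * g C) \<in> regular_funs ?K n" if "h \<in> regular_funs ?K n" for h
        using that reg(1) by (intro regular_funs.add regular_funs.mult regular_funs.const)
      then have qs_reg: "snd ` set qs \<subseteq> regular_funs ?K n"
      proof -
        have "h \<in> regular_funs ?K n" if "(d, h) \<in> set ys \<union> set zs" for d h
          using that reg(2,3) by force
        note upd' = upd[OF this]
        show ?thesis by (auto simp: qs_def intro: upd'[OF UnI1] upd'[OF UnI2])
      qed
      have split: "(\<Sum>(d, h)\<leftarrow>map (\<lambda>(d, h). (d, \<lambda>C. h C + e h * g C)) ws. d * h C) =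
          (\<Sum>(d, h)\<leftarrow>ws. d * h C) - (\<Sum>(d, h)\<leftarrow>ws. d * h B) * inverse (g B) * g C" for ws C
        by (induction ws) (auto simp: e_def algebra_simps)
      have "(\<Sum>(d, h)\<leftarrow>ys @ zs. d * h B) = - (c * g B)"
        using less.prems(2)[OF B(1)] by (simp add: ps eq_neg_iff_add_eq_0 algebra_simps)
      \<comment> \<open>Both lists represent the same function at every \<open>C\<close>, so the
        hypotheses pass to the shorter list and its conclusion passes back.\<close>
      then have eq: "(\<Sum>(d, h)\<leftarrow>qs. d * h C) = (\<Sum>(d, h)\<leftarrow>ps. d * h C)" for C
        unfolding qs_def split using B(2) by (simp add: ps)
      have "(\<Sum>(d, h)\<leftarrow>qs. d * h A) = 0"
        by (rule less.hyps[OF _ qs_reg]) (simp_all add: qs_def[symmetric] eq less.prems(2), simp add: qs_def ps)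
      then show ?thesis by (simp add: eq)
    qed
  qed
  obtain ps where ps: "snd ` set ps \<subseteq> regular_funs ?K n" "\<forall>A. f A = (\<Sum>(c, g)\<leftarrow>ps. c * g A)"
    using regular_funs_UNIV_span[OF K f(1)] by (elim exE conjE)
  then show ?thesis using vanish[OF ps(1)] f(2) by simp
qed

section \<open>Conjugation into a Levi subgroup\<close>

lemma map_mat_fixed_iff: "map_mat f A = A \<longleftrightarrow> (\<forall>a\<in>elements_mat A. f a = a)"
proof
  assume *: "map_mat f A = A"
  show "\<forall>a\<in>elements_mat A. f a = a"
  proof
    fix a assume "a \<in> elements_mat A"
    then obtain i j where ij: "i < dim_row A" "j < dim_col A" "a = A $$ (i, j)"
      using elements_matD by metis
    then show "f a = a" using arg_cong[OF *, of "\<lambda>M. M $$ (i, j)"] by simp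
  qed
next
  assume *: "\<forall>a\<in>elements_mat A. f a = a"
  show "map_mat f A = A"
  proof (rule eq_matI)
    fix i j assume ij: "i < dim_row A" "j < dim_col A"
    then have "A $$ (i, j) \<in> elements_mat A" by (intro elements_matI[of A "dim_row A" "dim_col A"]) auto
    then show "map_mat f A $$ (i, j) = A $$ (i, j)" using ij * by simp
  qed auto
qed

lemma finite_mats_over:
  assumes "finite K"
  shows "finite {A \<in> carrier_mat m m. elements_mat A \<subseteq> K}"
proof (rule finite_surj)
  let ?I = "{..<m} \<times> {..<m}"
  show "finite (?I \<rightarrow>\<^sub>E K)" using assms by (intro finite_PiE) auto
  show "{A \<in> carrier_mat m m. elements_mat A \<subseteq> K} \<subseteq> mat m m ` (?I \<rightarrow>\<^sub>E K)"
  proof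
    fix A assume "A \<in> {A \<in> carrier_mat m m. elements_mat A \<subseteq> K}"
    then have A: "A \<in> carrier_mat m m" "elements_mat A \<subseteq> K" by auto
    let ?f = "restrict (\<lambda>ij. A $$ ij) ?I"
    have "?f \<in> ?I \<rightarrow>\<^sub>E K"
    proof (rule restrict_PiE_iff[THEN iffD2], rule ballI)
      fix ij assume "ij \<in> ?I"
      then obtain i j where ij: "ij = (i, j)" "i < m" "j < m" by auto
      show "A $$ ij \<in> K"
        using A(2) elements_matI[OF A(1) ij(2,3) refl] ij(1) by (simp add: subset_iff)
    qed
    moreover have "A = mat m m ?f" using A(1) by (intro eq_matI) auto
    ultimately show "A \<in> mat m m ` (?I \<rightarrow>\<^sub>E K)" by (intro image_eqI[where x = ?f])
  qed
qed

text \<open>Fixed points correspond under \<open>\<phi>\<close> once the entrywise power map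
  preserves \<open>H\<^sub>0\<close>, for only there are \<open>\<phi>\<close> injective and
  \<open>inv_into\<close> its inverse. Definition over the prime field ensures this.\<close>

lemma frobenius_fixed_eq:
  fixes H\<^sub>0 :: "'a::field mat set"
  assumes p: "CHAR('a) > 0" and X: "closedin (zariski m) H\<^sub>0" "defined_over prime_field m H\<^sub>0"
    and \<phi>: "bij_betw \<phi> H\<^sub>0 H"
  shows "frobenius_fixed r H H\<^sub>0 \<phi> = \<phi> ` points_over (frobenius_fixed_elements r) H\<^sub>0"
proof -
  let ?F = "\<lambda>x::'a. x ^ (CHAR('a) ^ r)"
  have inj: "inj_on \<phi> H\<^sub>0" and img: "H = \<phi> ` H\<^sub>0" using \<phi> by (auto simp: bij_betw_def)
  have fix_prime: "?F c = c" if "c \<in> prime_field" for c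
    using that prime_field_subset_subring[OF is_subring_frobenius_fixed_elements[OF p, of r]]
    by (auto simp: frobenius_fixed_elements_def)
  have frob: "frobenius r H\<^sub>0 \<phi> (\<phi> A) = \<phi> A \<longleftrightarrow> A \<in> points_over (frobenius_fixed_elements r) H\<^sub>0"
    if A: "A \<in> H\<^sub>0" for A
  proof -
    have "map_mat ?F A \<in> H\<^sub>0"
      by (rule map_mat_hom_on_in_variety[OF is_subring_UNIV hom_on_frobenius[OF p] _ _ X A])
        (use fix_prime in auto)
    then have "frobenius r H\<^sub>0 \<phi> (\<phi> A) = \<phi> A \<longleftrightarrow> map_mat ?F A = A"
      unfolding frobenius_def inv_into_f_f[OF inj A] by (rule inj_on_eq_iff[OF inj _ A])
    then show ?thesis
      using A by (simp add: map_mat_fixed_iff points_over_def frobenius_fixed_elements_def subset_eq)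
  qed
  show ?thesis
    unfolding frobenius_fixed_def img using frob by (auto simp: points_over_def)
qed

lemma subgroup_points_over_frobenius_fixed:
  fixes H\<^sub>0 :: "'a::field mat set"
  assumes p: "CHAR('a) > 0" and H: "subgroup H\<^sub>0 (GL m)"
  shows "subgroup (points_over (frobenius_fixed_elements r) H\<^sub>0) (subgrp m H\<^sub>0)"
proof -
  interpret group "GL m :: 'a mat monoid" by (rule group_GL)
  interpret H: subgroup H\<^sub>0 "GL m" by (rule H)
  interpret F: comm_ring_hom "\<lambda>x::'a. x ^ (CHAR('a) ^ r)"
    using hom_on_frobenius[OF p, of UNIV r] hom_on_zero[OF is_subring_UNIV hom_on_frobenius[OF p]]
    by unfold_locales (auto simp: hom_on_def)
  let ?F = "map_mat (\<lambda>x::'a. x ^ (CHAR('a) ^ r))"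
  have eq: "points_over (frobenius_fixed_elements r) H\<^sub>0 = {A \<in> H\<^sub>0. ?F A = A}"
    by (auto simp: points_over_def map_mat_fixed_iff frobenius_fixed_elements_def subset_eq)
  have dim: "A \<in> carrier_mat m m" if "A \<in> H\<^sub>0" for A using H.mem_carrier[OF that] by (simp add: carrier_GL_iff)
  have "subgroup {A \<in> H\<^sub>0. ?F A = A} (GL m)"
  proof (rule subgroup.intro)
    show "{A \<in> H\<^sub>0. ?F A = A} \<subseteq> carrier (GL m)" by auto
    show "\<one>\<^bsub>GL m\<^esub> \<in> {A \<in> H\<^sub>0. ?F A = A}" using H.one_closed F.mat_hom_one by simp
  next
    fix A B assume "A \<in> {A \<in> H\<^sub>0. ?F A = A}" "B \<in> {A \<in> H\<^sub>0. ?F A = A}"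
    then show "A \<otimes>\<^bsub>GL m\<^esub> B \<in> {A \<in> H\<^sub>0. ?F A = A}"
      using H.m_closed[of A B] F.mat_hom_mult[OF dim dim, of A B] by simp
  next
    fix A assume "A \<in> {A \<in> H\<^sub>0. ?F A = A}"
    then have A: "A \<in> H\<^sub>0" "?F A = A" by auto
    let ?B = "inv\<^bsub>GL m\<^esub> A"
    have B: "?B \<in> H\<^sub>0" using A by simp
    \<comment> \<open>The image of the inverse is again a left inverse of the fixed matrix
      \<open>A\<close>, so uniqueness of inverses shows that \<open>?B\<close> is fixed.\<close>
    have "?F ?B * A = ?F (?B * A)" using F.mat_hom_mult[OF dim[OF B] dim[OF A(1)]] A(2) by simp
    also have "\<dots> = 1\<^sub>m m" using l_inv[OF H.mem_carrier[OF A(1)]] F.mat_hom_one by simp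
    finally have BA: "?F ?B * A = 1\<^sub>m m" .
    then have "det (?F ?B) * det A = 1" using det_mult[of "?F ?B" m A] dim[OF A(1)] dim[OF B] by simp
    then have "?F ?B \<in> carrier (GL m)" using dim[OF B] by (auto simp: carrier_GL_iff)
    then have "?B = ?F ?B" using BA H.mem_carrier[OF A(1)] by (intro inv_equality) auto
    then show "?B \<in> {A \<in> H\<^sub>0. ?F A = A}" using B by simp
  qed
  then show ?thesis unfolding eq by (rule subgroup_incl[OF _ H]) auto
qed

text \<open>Conjugation by \<open>g\<close> is a homomorphism, so the image of \<open>X\<close> is
  automatically a group and only its inclusion in \<open>L\<close> matters. Conjugacy thus becomes a
  condition on single elements, each expressible by equations in \<open>g\<close>.\<close>

lemma conjugate_to_subgroup_iff:
  fixes G X L :: "'a::field mat set"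
  assumes G: "G \<subseteq> carrier (GL n)" and X: "subgroup X (GL n)" and L: "subgroup L (GL n)"
  shows "conjugate_to_subgroup n G X L \<longleftrightarrow> (\<exists>g\<in>G. \<forall>x\<in>X. g * x * inv\<^bsub>GL n\<^esub> g \<in> L)"
proof -
  interpret group "GL n :: 'a mat monoid" by (rule group_GL)
  have "subgroup ((\<lambda>x. g \<otimes>\<^bsub>GL n\<^esub> x \<otimes>\<^bsub>GL n\<^esub> inv\<^bsub>GL n\<^esub> g) ` X) (subgrp n L) \<longleftrightarrow>
      (\<forall>x\<in>X. g \<otimes>\<^bsub>GL n\<^esub> x \<otimes>\<^bsub>GL n\<^esub> inv\<^bsub>GL n\<^esub> g \<in> L)" (is "?l \<longleftrightarrow> ?r") if g: "g \<in> carrier (GL n)" for g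
  proof
    assume ?l
    from subgroup.subset[OF this] show ?r by auto
  next
    assume ?r
    have "group_hom (GL n) (GL n) (\<lambda>x. g \<otimes>\<^bsub>GL n\<^esub> x \<otimes>\<^bsub>GL n\<^esub> inv\<^bsub>GL n\<^esub> g)"
    proof unfold_locales
      show "(\<lambda>x. g \<otimes>\<^bsub>GL n\<^esub> x \<otimes>\<^bsub>GL n\<^esub> inv\<^bsub>GL n\<^esub> g) \<in> hom (GL n) (GL n)"
      proof (rule homI)
        fix x y :: "'a mat" assume xy: "x \<in> carrier (GL n)" "y \<in> carrier (GL n)"
        have "(g \<otimes>\<^bsub>GL n\<^esub> x \<otimes>\<^bsub>GL n\<^esub> inv\<^bsub>GL n\<^esub> g) \<otimes>\<^bsub>GL n\<^esub> (g \<otimes>\<^bsub>GL n\<^esub> y \<otimes>\<^bsub>GL n\<^esub> inv\<^bsub>GL n\<^esub> g)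
            = g \<otimes>\<^bsub>GL n\<^esub> x \<otimes>\<^bsub>GL n\<^esub> (inv\<^bsub>GL n\<^esub> g \<otimes>\<^bsub>GL n\<^esub> g) \<otimes>\<^bsub>GL n\<^esub> y \<otimes>\<^bsub>GL n\<^esub> inv\<^bsub>GL n\<^esub> g"
          using g xy by (simp only: m_assoc m_closed inv_closed)
        also have "\<dots> = g \<otimes>\<^bsub>GL n\<^esub> (x \<otimes>\<^bsub>GL n\<^esub> y) \<otimes>\<^bsub>GL n\<^esub> inv\<^bsub>GL n\<^esub> g"
          using g xy by (simp only: l_inv r_one m_assoc m_closed inv_closed)
        finally show "g \<otimes>\<^bsub>GL n\<^esub> (x \<otimes>\<^bsub>GL n\<^esub> y) \<otimes>\<^bsub>GL n\<^esub> inv\<^bsub>GL n\<^esub> g =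
            (g \<otimes>\<^bsub>GL n\<^esub> x \<otimes>\<^bsub>GL n\<^esub> inv\<^bsub>GL n\<^esub> g) \<otimes>\<^bsub>GL n\<^esub> (g \<otimes>\<^bsub>GL n\<^esub> y \<otimes>\<^bsub>GL n\<^esub> inv\<^bsub>GL n\<^esub> g)" by (rule sym)
      qed (use g in \<open>simp only: m_closed inv_closed\<close>)
    qed
    from group_hom.subgroup_img_is_subgroup[OF this X] show ?l
      by (rule subgroup_incl[OF _ L]) (use \<open>?r\<close> in auto)
  qed
  with G show ?thesis unfolding conjugate_to_subgroup_def by (simp add: subset_iff cong: bex_cong)
qed

text \<open>\<open>alg_group_iso_over\<close> supplies regular entries only. As
  \<open>\<phi>\<close> respects inverses, the inverse determinant of \<open>\<phi> A\<close> is the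
  determinant of \<open>\<phi>\<close> at the inverse of \<open>A\<close>, and inversion is
  regular.\<close>

lemma regular_GL_map_alg_group_iso:
  fixes \<phi> :: "'a::field mat \<Rightarrow> 'a mat"
  assumes X: "subgroup X (GL m)" and Y: "subgroup Y (GL n)"
    and \<phi>: "alg_group_iso_over UNIV m X n Y \<phi>"
  shows "regular_GL_map m X n \<phi>"
proof -
  interpret group "GL m :: 'a mat monoid" by (rule group_GL)
  interpret Gn: group "GL n :: 'a mat monoid" by (rule group_GL)
  have XG: "X \<subseteq> carrier (GL m)" by (rule subgroup.subset[OF X])
  have hom: "\<phi> \<in> hom (subgrp m X) (subgrp n Y)"
    using \<phi> by (simp add: alg_group_iso_over_def iso_def)
  have gh: "group_hom (subgrp m X) (subgrp n Y) \<phi>"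
    by (intro group_hom.intro group_hom_axioms.intro hom subgroup_imp_group[OF X] Gn.subgroup_imp_group[OF Y])
  have reg: "regular_on m X (\<lambda>A. \<phi> A $$ (i, j))" if "i < n" "j < n" for i j
    using \<phi> that by (simp add: alg_group_iso_over_def regular_map_over_def regular_on_def)
  have Y': "\<phi> A \<in> Y" if "A \<in> X" for A using hom_carrier[OF hom] that by auto
  have GLn: "\<phi> A \<in> carrier (GL n)" if "A \<in> X" for A
    using Y'[OF that] subgroup.subset[OF Y] by blast
  have invX: "inv\<^bsub>GL m\<^esub> A \<in> X" if "A \<in> X" for A by (rule subgroup.m_inv_closed[OF X that])
  have "regular_on m X (\<lambda>A. det (\<phi> (inv\<^bsub>GL m\<^esub> A)))"
  proof (rule regular_on_det)
    show "\<phi> (inv\<^bsub>GL m\<^esub> A) \<in> carrier_mat n n" if "A \<in> X" for A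
      using GLn[OF invX[OF that]] by (simp add: carrier_GL_iff)
    fix i j assume ij: "i < n" "j < n"
    obtain f where f: "f \<in> regular_funs UNIV m" "\<And>A. A \<in> X \<Longrightarrow> \<phi> A $$ (i, j) = f A"
      using reg[OF ij] by (auto simp: regular_on_def)
    show "regular_on m X (\<lambda>A. \<phi> (inv\<^bsub>GL m\<^esub> A) $$ (i, j))"
      by (rule regular_on_cong[OF regular_on_comp[OF regular_GL_map_inv[OF XG] f(1)]])
        (rule f(2)[OF invX])
  qed
  moreover have "inverse (det (\<phi> A)) = det (\<phi> (inv\<^bsub>GL m\<^esub> A))" if A: "A \<in> X" for A
  proof -
    have "\<phi> (inv\<^bsub>GL m\<^esub> A) = inv\<^bsub>GL n\<^esub> (\<phi> A)"
      using group_hom.hom_inv[OF gh, of A] A m_inv_consistent[OF X A] Gn.m_inv_consistent[OF Y Y'[OF A]]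
      by simp
    then show ?thesis using det_inv_GL[OF GLn[OF A]] by (metis inverse_inverse_eq)
  qed
  ultimately have "regular_on m X (\<lambda>A. inverse (det (\<phi> A)))" by (rule regular_on_cong)
  with reg GLn show ?thesis by (simp add: regular_GL_map_def)
qed

theorem corollary3p6p3:
  fixes G H P L H\<^sub>0 :: "'a::alg_closed_field mat set"
    and \<phi> :: "'a mat \<Rightarrow> 'a mat"
    and n m :: nat
  assumes "CHAR('a) > 0"
    and "connected_subgroup n G" and "reductive n G"
    and "connected_subgroup n H" and "reductive n H" and "H \<subseteq> G"
    and "split_prime_structure n H m H\<^sub>0 \<phi>"
    and "parabolic_subgroup n G P" and "levi_subgroup n P L"
    and "H \<subseteq> P"
  shows "\<exists>r>0. finite (frobenius_fixed r H H\<^sub>0 \<phi>) \<and>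
           subgroup (frobenius_fixed r H H\<^sub>0 \<phi>) (subgrp n H) \<and>
           (conjugate_to_subgroup n G (frobenius_fixed r H H\<^sub>0 \<phi>) L \<longleftrightarrow>
            conjugate_to_subgroup n G H L)"
proof -
  note p = assms(1)
  interpret group "GL n :: 'a mat monoid" by (rule group_GL)
  interpret Gm: group "GL m :: 'a mat monoid" by (rule group_GL)
  let ?K = "prime_field_closure :: 'a set"
  have "subgroup G (GL n)" and H: "subgroup H (GL n)"
    and L: "subgroup L (GL n)" "closedin (zariski n) L"
    and H0: "subgroup H\<^sub>0 (GL m)" "closedin (zariski m) H\<^sub>0" "defined_over prime_field m H\<^sub>0"
    and iso: "alg_group_iso_over UNIV m H\<^sub>0 n H \<phi>"
    using assms
    by (auto simp: connected_subgroup_def closed_subgroup_def levi_subgroup_def split_prime_structure_def)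
  then have G: "G \<subseteq> carrier (GL n)" by (intro subgroup.subset)
  have \<phi>: "\<phi> \<in> hom (subgrp m H\<^sub>0) (subgrp n H)" "bij_betw \<phi> H\<^sub>0 H"
    using iso by (auto simp: alg_group_iso_over_def iso_def)
  then have img: "H = \<phi> ` H\<^sub>0" by (simp add: bij_betw_def)
  have HG: "H \<subseteq> carrier (GL n)" by (rule subgroup.subset[OF H])
  have \<phi>_reg: "regular_GL_map m H\<^sub>0 n \<phi>" by (rule regular_GL_map_alg_group_iso[OF H0(1) H iso])
  note fixed = frobenius_fixed_eq[OF p H0(2,3) \<phi>(2)]
  have sub: "subgroup (frobenius_fixed r H H\<^sub>0 \<phi>) (subgrp n H)" for r
  proof -
    have "group_hom (subgrp m H\<^sub>0) (subgrp n H) \<phi>"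
      by (intro group_hom.intro group_hom_axioms.intro \<phi>(1) Gm.subgroup_imp_group[OF H0(1)]
          subgroup_imp_group[OF H])
    from group_hom.subgroup_img_is_subgroup[OF this subgroup_points_over_frobenius_fixed[OF p H0(1)]]
    show ?thesis unfolding fixed .
  qed
  have fin: "finite (frobenius_fixed r H H\<^sub>0 \<phi>)" if "r > 0" for r
  proof -
    have "points_over (frobenius_fixed_elements r) H\<^sub>0 \<subseteq>
        {A \<in> carrier_mat m m. elements_mat A \<subseteq> frobenius_fixed_elements r}"
      using subgroup.subset[OF H0(1)] by (auto simp: points_over_def carrier_GL_iff)
    then show ?thesis
      unfolding fixed
      by (intro finite_imageI) (rule finite_subset[OF _ finite_mats_over[OF finite_frobenius_fixed_elements[OF p that]]])
  qed
  define I where "I = {f \<in> regular_funs UNIV n. \<forall>A\<in>L. f A = 0}"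
  let ?conj = "\<lambda>g x. g * x * inv\<^bsub>GL n\<^esub> g"
  define E where "E A = {c \<in> regular_funs UNIV n. \<exists>f\<in>I. \<forall>g\<in>carrier (GL n). c g = f (?conj g (\<phi> A))}" for A
  define F where "F = (\<Union>A\<in>points_over ?K H\<^sub>0. E A)"
  have conj_GL: "?conj g x \<in> carrier (GL n)" if "g \<in> carrier (GL n)" "x \<in> carrier (GL n)" for g x :: "'a mat"
    using m_closed[OF m_closed[OF that] inv_closed[OF that(1)]] by simp
  have "F \<subseteq> regular_funs UNIV n" by (auto simp: F_def E_def)
  from regular_funs_noetherian[OF this] obtain F' where
    F': "F' \<subseteq> F" "finite F'" "\<And>g. \<forall>c\<in>F'. c g = 0 \<Longrightarrow> \<forall>c\<in>F. c g = 0" by metis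
  \<comment> \<open>Each equation of the finite system comes from a point \<open>a c\<close> over
    the small field. Their finitely many entries lie in one finite field, which determines
    \<open>r\<close> before any \<open>g\<close> is considered.\<close>
  have "\<forall>c\<in>F'. \<exists>A\<in>points_over ?K H\<^sub>0. c \<in> E A" using F'(1) by (auto simp: F_def)
  then obtain a where a: "\<And>c. c \<in> F' \<Longrightarrow> a c \<in> points_over ?K H\<^sub>0 \<and> c \<in> E (a c)" by metis
  have "finite (\<Union>c\<in>F'. elements_mat (a c))" using F'(2) by (auto simp: elements_mat_def)
  moreover have "(\<Union>c\<in>F'. elements_mat (a c)) \<subseteq> ?K" using a by (auto simp: points_over_def)
  ultimately obtain r where r: "r > 0" "(\<Union>c\<in>F'. elements_mat (a c)) \<subseteq> frobenius_fixed_elements r"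
    using finite_subset_prime_field_closure by metis
  have "\<forall>x\<in>H. ?conj g x \<in> L"
    if g: "g \<in> G" "\<forall>x\<in>frobenius_fixed r H H\<^sub>0 \<phi>. ?conj g x \<in> L" for g
  proof
    have gG: "g \<in> carrier (GL n)" using g(1) G by blast
    have "c g = 0" if c: "c \<in> F'" for c
    proof -
      have "a c \<in> points_over (frobenius_fixed_elements r) H\<^sub>0"
        using a[OF c] r(2) c by (auto simp: points_over_def)
      then have "?conj g (\<phi> (a c)) \<in> L" using g(2) by (simp add: fixed)
      moreover obtain f where "f \<in> I" "c g = f (?conj g (\<phi> (a c)))"
        using a[OF c] gG by (auto simp: E_def)
      ultimately show ?thesis by (simp add: I_def)
    qed
    then have vanish: "c g = 0" if "c \<in> F" for c using F'(3)[of g] that by blast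
    fix x assume "x \<in> H"
    then obtain A where A: "A \<in> H\<^sub>0" "x = \<phi> A" unfolding img by blast
    have xG: "x \<in> carrier (GL n)" using HG \<open>x \<in> H\<close> by blast
    show "?conj g x \<in> L"
    proof (rule closedin_zariskiI[OF L(2) conj_GL[OF gG xG]])
      fix f assume f: "f \<in> regular_funs UNIV n" "\<forall>A\<in>L. f A = 0"
      \<comment> \<open>Here \<open>g\<close> is fixed and the matrix varies: the pullback of
        \<open>f\<close> is a regular function \<open>u\<close> on \<open>H\<^sub>0\<close>, to
        which density applies.\<close>
      have "regular_GL_map m H\<^sub>0 n (\<lambda>B. ?conj g (\<phi> B))"
        using gG by (intro regular_GL_map_mult regular_GL_map_const \<phi>_reg inv_closed)
      from regular_on_comp[OF this f(1)] obtain u where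
        u: "u \<in> regular_funs UNIV m" "\<And>B. B \<in> H\<^sub>0 \<Longrightarrow> f (?conj g (\<phi> B)) = u B"
        by (auto simp: regular_on_def)
      have "u B = 0" if B: "B \<in> points_over ?K H\<^sub>0" for B
      proof -
        have BH: "B \<in> H\<^sub>0" using B by (simp add: points_over_def)
        then have "\<phi> B \<in> carrier (GL n)" using \<phi>_reg by (simp add: regular_GL_map_def)
        \<comment> \<open>The same expression with \<open>B\<close> fixed and \<open>g\<close>
          varying is one of the equations in \<open>E B\<close>, and \<open>g\<close> satisfies all
          of them by \<open>vanish\<close>.\<close>
        then have "regular_GL_map n (carrier (GL n)) n (\<lambda>g. ?conj g (\<phi> B))"
          by (intro regular_GL_map_mult regular_GL_map_const regular_GL_map_id regular_GL_map_inv subset_refl)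
        from regular_on_comp[OF this f(1)] obtain c where
          c: "c \<in> regular_funs UNIV n" "\<And>g. g \<in> carrier (GL n) \<Longrightarrow> f (?conj g (\<phi> B)) = c g"
          by (auto simp: regular_on_def)
        have "c \<in> E B" unfolding E_def I_def using c f by auto
        then have "c \<in> F" using B by (auto simp: F_def)
        then show ?thesis using vanish c(2)[OF gG] u(2)[OF BH] by simp
      qed
      from points_over_prime_field_closure_dense[OF p H0(2,3) u(1) this A(1)]
      show "f (?conj g x) = 0" using u(2)[OF A(1)] A(2) by simp
    qed
  qed
  moreover have "frobenius_fixed r H H\<^sub>0 \<phi> \<subseteq> H" by (auto simp: frobenius_fixed_def)
  ultimately have "(\<exists>g\<in>G. \<forall>x\<in>frobenius_fixed r H H\<^sub>0 \<phi>. ?conj g x \<in> L) \<longleftrightarrow>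
      (\<exists>g\<in>G. \<forall>x\<in>H. ?conj g x \<in> L)" by blast
  then have "conjugate_to_subgroup n G (frobenius_fixed r H H\<^sub>0 \<phi>) L \<longleftrightarrow> conjugate_to_subgroup n G H L"
    using conjugate_to_subgroup_iff[OF G incl_subgroup[OF H sub] L(1)] conjugate_to_subgroup_iff[OF G H L(1)]
    by simp
  with r(1) fin sub show ?thesis by blast
qed

end
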